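(* Let $0 \le r_1 < r_2 \le n/2$ be integers, let $B = \bigcup_{i=r_1}^{r_2} S(n,i)$, and let $A$ be the adjacency matrix of the subgraph of the Hamming cube $\{0,1\}^n$ induced by $B$. For $0 \le t \le r_2$ write $t^* = \max\{t, r_1\}$ and let $\Lambda_t$ be the set of eigenvalues of the matrix $M_t$ defined below. Then: (1) For each $t = 0,\dots,r_2$ and each of the $r_2 - t^* + 1$ distinct real numbers $\lambda \in \Lambda_t$, the matrix $A$ has an eigenspace $W_t(\lambda)$ (a subspace of eigenvectors with eigenvalue $\lambda$) of dimension $\binom{n}{t} - \binom{n}{t-1}$. (2) Let $f \in W_t(\lambda)$. Then for each $i$ with $t^* \le i \le r_2$, the restriction of $f$ to $S(n,i)$ lies in the $t$-th eigenspace $V_t$ of $S(n,i)$. Furthermore, $f$ vanishes on $\bigcup_{i=0}^{t^*-1} S(n,i) \cap B$. The restrictions of functions in $W_t(\lambda)$ to $S(n,t^* )$ span the $t$-th eigenspace $V_t$ of $S(n,t^* )$, and a function $f \in W_t(\lambda)$ is determined by its restriction to $S(n,t^* )$. (3) A real number $\lambda$ is an eigenvalue of $A$ if and only if $\lambda \in \bigcup_{t=0}^{r_2}\Lambda_t$, and its multiplicity is $m(\lambda) = \sum_{t : \lambda \in \Lambda_t}\left(\binom{n}{t}-\binom{n}{t-1}\right)$, with $\binom{n}{-1}:=0$.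
   Context: $\{0,1\}^n$ is the Hamming cube (vertices adjacent iff Hamming distance $1$); points are identified with subsets of $\{1,\dots,n\}$ and $|x|$ is the weight. $S(n,i)=\{x:|x|=i\}$ with inner product $\langle f,g\rangle=\sum_{x\in S(n,i)}f(x)g(x)$. For $|z|\le i$, $g_z$ on $S(n,i)$ is $1$ at $x$ if $z\subseteq x$ and $0$ otherwise; $U_j=\mathrm{span}\{g_z:|z|\le j\}$; the eigenspaces of $S(n,i)$ are $V_0=U_0$ (constants) and $V_j=U_j\cap U_{j-1}^\perp$ for $1\le j\le i$. For $0\le t\le r_2$, $M_t$ is the symmetric tridiagonal $(r_2-t^*+1)\times(r_2-t^*+1)$ matrix with zero diagonal and off-diagonal entries (in order) $\sqrt{\lambda_{t^*-t+2}}, \sqrt{\lambda_{t^*-t+3}},\dots,\sqrt{\lambda_{r_2-t+1}}$, where $\lambda_k=(k-1)(n-2t-k+2)$; if $r_2=t^*$ it is the $1\times 1$ zero matrix. These off-diagonal entries are positive, so $M_t$ has $r_2-t^*+1$ distinct real eigenvalues. *)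

theory Defs
  imports "HOL-Library.Function_Algebras" "Jordan_Normal_Form.Char_Poly"
begin

text \<open>Points of the cube are subsets of {1..n} (type nat set); functions on the
cube (or on subsets of it) are functions nat set => real, with explicit support
conditions. The real vector space structure is given by pointwise scaling.\<close>

definition fscale :: "real \<Rightarrow> (nat set \<Rightarrow> real) \<Rightarrow> (nat set \<Rightarrow> real)" where
  "fscale c f = (\<lambda>x. c * f x)"

abbreviation fspan :: "(nat set \<Rightarrow> real) set \<Rightarrow> (nat set \<Rightarrow> real) set" where
  "fspan \<equiv> module.span fscale"

abbreviation fsubspace :: "(nat set \<Rightarrow> real) set \<Rightarrow> bool" where
  "fsubspace \<equiv> module.subspace fscale"

abbreviation fdim :: "(nat set \<Rightarrow> real) set \<Rightarrow> nat" where
  "fdim \<equiv> vector_space.dim fscale"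

definition layer :: "nat \<Rightarrow> nat \<Rightarrow> nat set set" where
  "layer n i = {x. x \<subseteq> {1..n} \<and> card x = i}"

definition band :: "nat \<Rightarrow> nat \<Rightarrow> nat \<Rightarrow> nat set set" where
  "band n r1 r2 = {x. x \<subseteq> {1..n} \<and> r1 \<le> card x \<and> card x \<le> r2}"

definition hadj :: "nat set \<Rightarrow> nat set \<Rightarrow> bool" where
  "hadj x y \<longleftrightarrow> card ((x - y) \<union> (y - x)) = 1"

definition funs_on :: "nat set set \<Rightarrow> (nat set \<Rightarrow> real) set" where
  "funs_on X = {f. \<forall>x. x \<notin> X \<longrightarrow> f x = 0}"

definition adjop :: "nat \<Rightarrow> nat \<Rightarrow> nat \<Rightarrow> (nat set \<Rightarrow> real) \<Rightarrow> (nat set \<Rightarrow> real)" where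
  "adjop n r1 r2 f = (\<lambda>x. if x \<in> band n r1 r2
      then (\<Sum>y\<in>{y \<in> band n r1 r2. hadj x y}. f y) else 0)"

definition eigsp :: "nat \<Rightarrow> nat \<Rightarrow> nat \<Rightarrow> real \<Rightarrow> (nat set \<Rightarrow> real) set" where
  "eigsp n r1 r2 lam = {f \<in> funs_on (band n r1 r2). adjop n r1 r2 f = fscale lam f}"

definition is_eigenvalue_A :: "nat \<Rightarrow> nat \<Rightarrow> nat \<Rightarrow> real \<Rightarrow> bool" where
  "is_eigenvalue_A n r1 r2 lam \<longleftrightarrow> (\<exists>f \<in> eigsp n r1 r2 lam. f \<noteq> 0)"

definition restr :: "nat \<Rightarrow> nat \<Rightarrow> (nat set \<Rightarrow> real) \<Rightarrow> (nat set \<Rightarrow> real)" where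
  "restr n i f = (\<lambda>x. if x \<in> layer n i then f x else 0)"

definition gfun :: "nat \<Rightarrow> nat \<Rightarrow> nat set \<Rightarrow> (nat set \<Rightarrow> real)" where
  "gfun n i z = (\<lambda>x. if x \<in> layer n i \<and> z \<subseteq> x then 1 else 0)"

definition Usp :: "nat \<Rightarrow> nat \<Rightarrow> nat \<Rightarrow> (nat set \<Rightarrow> real) set" where
  "Usp n i j = fspan {gfun n i z | z. z \<subseteq> {1..n} \<and> card z \<le> j}"

definition perp_layer :: "nat \<Rightarrow> nat \<Rightarrow> (nat set \<Rightarrow> real) set \<Rightarrow> (nat set \<Rightarrow> real) set" where
  "perp_layer n i X = {f \<in> funs_on (layer n i). \<forall>g\<in>X. (\<Sum>x\<in>layer n i. f x * g x) = 0}"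

definition Vsp :: "nat \<Rightarrow> nat \<Rightarrow> nat \<Rightarrow> (nat set \<Rightarrow> real) set" where
  "Vsp n i j = (if j = 0 then Usp n i 0 else Usp n i j \<inter> perp_layer n i (Usp n i (j - 1)))"

definition lamk :: "nat \<Rightarrow> nat \<Rightarrow> nat \<Rightarrow> real" where
  "lamk n t k = real (k - 1) * (real n - 2 * real t - real k + 2)"

definition Mt :: "nat \<Rightarrow> nat \<Rightarrow> nat \<Rightarrow> nat \<Rightarrow> real mat" where
  "Mt n r1 r2 t = (let ts = max t r1; N = r2 - ts + 1 in
     mat N N (\<lambda>(i, j).
       if j = Suc i then sqrt (lamk n t (ts - t + 2 + i))
       else if i = Suc j then sqrt (lamk n t (ts - t + 2 + j))
       else 0))"

definition multt :: "nat \<Rightarrow> nat \<Rightarrow> int" where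
  "multt n t = int (n choose t) - (if t = 0 then 0 else int (n choose (t - 1)))"

end

theory Submission
  imports Defs "HOL-Computational_Algebra.Fundamental_Theorem_Algebra"
    "HOL-Library.Indicator_Function"
begin

text \<open>Let \<open>U\<close> and \<open>D\<close> be the raising and lowering operators between consecutive layers; on the band
  the adjacency operator is \<open>U + D\<close>. From \<open>[D, U] = n - 2 i\<close> on layer \<open>i\<close> one gets
  \<open>D U\<^sup>k h = \<lambda>\<^sub>k\<^sub>+\<^sub>1 U\<^sup>k\<^sup>-\<^sup>1 h\<close> for every \<open>h\<close> in \<open>H t\<close>, the kernel of \<open>D\<close> on layer \<open>t\<close>. As these
  numbers are positive below the middle layer, each layer \<open>i \<le> n / 2\<close> is the direct sum of the spaces
  \<open>U\<^sup>i\<^sup>-\<^sup>t (H t)\<close>, which are the eigenspaces \<open>V t\<close>. For fixed \<open>h\<close> the adjacency operator acts on the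
  span of the \<open>U\<^sup>i\<^sup>-\<^sup>t h\<close> by a tridiagonal matrix diagonally similar to \<open>M t\<close>, so its eigenvectors
  are given by the orthogonal polynomials of that matrix, whose roots are real and simple.\<close>

section \<open>Jacobi matrices and their orthogonal polynomials\<close>

text \<open>Origin of the constants: since D h = 0, lowering U^(s+1) h produces the sum of n -
  2(t+r) over r = 0, ..., s, which is (s+1)(n-2t-s), the number lambda with index s+2. The chain of
  h enters the band in layer \<open>max t r1\<close>; the lowest coupling, from the layer above it
  back into it, therefore has index \<open>max t r1 - t + 2\<close>. The step below this layer never
  contributes: for t < r1 the band cuts it off, and otherwise h is harmonic. In the basis U^(i-t) h
  the matrix has ones on one side of the diagonal and the lambdas on the other. Its eigenvectors
  have coordinates p_k divided by the product of the first k couplings, and at the top layer, where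
  no next coordinate exists, exactly the value p_N is left over. This end condition selects the
  eigenvalues. Completeness rests on uniqueness of the harmonic decomposition in every layer: an
  arbitrary eigenvector splits into degrees, and each degree has to obey the same recurrence and the
  same end condition. The same uniqueness makes the sum of the spaces for one eigenvalue direct, so
  multiplicities add.\<close>

fun jacobi_poly :: "(nat \<Rightarrow> real) \<Rightarrow> nat \<Rightarrow> real poly" where
  "jacobi_poly b 0 = 1"
| "jacobi_poly b (Suc 0) = [:0, 1:]"
| "jacobi_poly b (Suc (Suc k)) = [:0, 1:] * jacobi_poly b (Suc k) - Polynomial.smult (b k) (jacobi_poly b k)"

text \<open>\<open>jacobi_poly b k\<close> is the characteristic polynomial of the leading k by k
  block: expanding along the last row gives the three-term recurrence, with \<open>b k\<close> the
  square of the entry coupling k and k+1.\<close>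

definition jacobi_mat :: "(nat \<Rightarrow> real) \<Rightarrow> nat \<Rightarrow> real mat" where
  "jacobi_mat b N = mat N N (\<lambda>(i, j).
     if j = Suc i then sqrt (b i) else if i = Suc j then sqrt (b j) else 0)"

lemma degree_lead_coeff_jacobi_poly:
  "degree (jacobi_poly b k) = k \<and> lead_coeff (jacobi_poly b k) = 1"
proof (induction k rule: induct_nat_012)
  case (ge2 k)
  let ?p = "[:0, 1:] * jacobi_poly b (Suc k)" and ?q = "Polynomial.smult (b k) (jacobi_poly b k)"
  have nz: "jacobi_poly b (Suc k) \<noteq> 0"
    using ge2 by auto
  have p: "degree ?p = Suc (Suc k)" "lead_coeff ?p = 1"
    using ge2 nz by (auto simp: degree_mult_eq)
  have q: "degree ?q < degree ?p"
    unfolding p(1) using ge2 by (intro le_less_trans[OF degree_smult_le]) auto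
  have "degree (?p - ?q) = Suc (Suc k)"
    using degree_add_eq_left[of "- ?q" ?p] q p by simp
  moreover have "coeff ?q (Suc (Suc k)) = 0"
    using q p(1) by (metis coeff_eq_0)
  ultimately show ?case
    using p by (simp del: mult_pCons_left)
qed auto

lemma degree_jacobi_poly: "degree (jacobi_poly b k) = k"
  and jacobi_poly_nonzero: "jacobi_poly b k \<noteq> 0"
  using degree_lead_coeff_jacobi_poly[of b k] by auto

text \<open>On the open upper half-plane the quotients of consecutive values stay in the upper
  half-plane.\<close>

lemma jacobi_poly_upper_half_plane:
  fixes z :: complex
  assumes z: "Im z > 0" and "\<And>i. Suc i < Suc k \<Longrightarrow> b i > 0"
  shows "poly (map_poly of_real (jacobi_poly b k)) z \<noteq> 0 \<and>
    Im (poly (map_poly of_real (jacobi_poly b (Suc k))) z /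
        poly (map_poly of_real (jacobi_poly b k)) z) > 0"
  using assms(2)
proof (induction k)
  case (Suc k)
  define p where "p i = poly (map_poly of_real (jacobi_poly b i)) z" for i
  have IH: "p k \<noteq> 0" "Im (p (Suc k) / p k) > 0"
    using Suc by (auto simp: p_def)
  have b: "b k > 0"
    using Suc.prems by auto
  have nz: "p (Suc k) \<noteq> 0"
    using IH by auto
  have minus: "map_poly complex_of_real (p - q) = map_poly of_real p - map_poly of_real q" for p q
    by (rule poly_eqI) (simp add: coeff_map_poly)
  have rec: "p (Suc (Suc k)) = z * p (Suc k) - of_real (b k) * p k"
    by (simp add: p_def minus hom_distribs)
  \<comment> \<open>Inversion sends the upper half-plane to the lower one, multiplication by
    \<open>- b k\<close> sends it back, and adding z moves further up.\<close>
  have "p (Suc (Suc k)) / p (Suc k) = z - of_real (b k) * inverse (p (Suc k) / p k)"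
    using IH nz by (simp add: rec field_simps)
  moreover have "Im (inverse w) < 0" if "Im w > 0" for w
    using that by (auto intro!: divide_pos_pos add_nonneg_pos)
  from this[OF IH(2)] have "Im (inverse (p (Suc k) / p k)) < 0" .
  ultimately have "Im (p (Suc (Suc k)) / p (Suc k))
      = Im z - b k * Im (inverse (p (Suc k) / p k))" "Im (inverse (p (Suc k) / p k)) < 0"
    by (simp_all only: minus_complex.sel times_complex.sel Re_complex_of_real Im_complex_of_real)
  then have "Im (p (Suc (Suc k)) / p (Suc k)) > 0"
    using mult_pos_neg[OF b] z by (smt (verit))
  then show ?case
    using nz by (simp add: p_def)
qed (use z in \<open>auto simp: map_poly_pCons\<close>)

text \<open>The left-hand side is the Wronskian of two consecutive polynomials.\<close>

lemma jacobi_poly_wronskian: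
  assumes "\<And>i. Suc i < Suc k \<Longrightarrow> b i > 0"
  shows "poly (pderiv (jacobi_poly b (Suc k))) x * poly (jacobi_poly b k) x
    - poly (jacobi_poly b (Suc k)) x * poly (pderiv (jacobi_poly b k)) x > 0"
  using assms
proof (induction k)
  case (Suc k)
  let ?W = "\<lambda>k. poly (pderiv (jacobi_poly b (Suc k))) x * poly (jacobi_poly b k) x
    - poly (jacobi_poly b (Suc k)) x * poly (pderiv (jacobi_poly b k)) x"
  \<comment> \<open>Confluent Christoffel-Darboux identity: the Wronskian is a positive combination
    of squares, starting from the value 1.\<close>
  have "?W (Suc k) = (poly (jacobi_poly b (Suc k)) x)\<^sup>2 + b k * ?W k"
    by (simp add: pderiv_diff pderiv_smult pderiv_mult pderiv_pCons algebra_simps power2_eq_square)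
  moreover have "?W k > 0" "b k > 0"
    using Suc by auto
  ultimately show ?case
    by (metis add_nonneg_pos mult_pos_pos zero_le_power2)
qed (simp add: pderiv_pCons)

text \<open>The count is made over the complex numbers. No root lies in the upper half-plane, hence
  by conjugation none in the lower one; at a multiple root, which would be real, the Wronskian would
  vanish. So the polynomial is squarefree with only real roots, as many as its degree.\<close>

lemma card_roots_jacobi_poly:
  assumes pos: "\<And>i. Suc i < N \<Longrightarrow> b i > 0"
  shows "card {x. poly (jacobi_poly b N) x = 0} = N"
proof (cases N)
  case (Suc k)
  let ?p = "jacobi_poly b N"
  let ?P = "map_poly complex_of_real ?p"
  have deg: "degree ?P = N"
    by (simp add: degree_jacobi_poly)
  have lead: "coeff ?p N = 1"
    using degree_lead_coeff_jacobi_poly[of b N] by metis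
  have upper: "poly ?P z \<noteq> 0" if "Im z > 0" for z
    using jacobi_poly_upper_half_plane[OF that, of k b] pos Suc by auto
  have cnj: "poly ?P (cnj z) = cnj (poly ?P z)" for z
    by (rule poly_cnj_real[symmetric]) (simp add: coeff_map_poly)
  have real_root: "z = of_real (Re z)" if "poly ?P z = 0" for z
  proof -
    have "\<not> Im z > 0" "\<not> Im (cnj z) > 0"
      using upper[of z] upper[of "cnj z"] cnj[of z] that by auto
    then show ?thesis
      by (simp add: complex_eq_iff)
  qed
  have "rsquarefree ?P"
    unfolding rsquarefree_roots
  proof (intro allI notI)
    fix z assume z: "poly ?P z = 0 \<and> poly (pderiv ?P) z = 0"
    define x where "x = Re z"
    have "z = of_real x"
      using real_root z x_def by blast
    then have "poly ?p x = 0" "poly (pderiv ?p) x = 0"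
      using z by (simp_all add: of_real_hom.map_poly_pderiv[symmetric])
    then show False
      using jacobi_poly_wronskian[of k b x] pos Suc by simp
  qed
  then have eq: "Polynomial.smult (lead_coeff ?P) (\<Prod>z | poly ?P z = 0. [:- z, 1:]) = ?P"
    by (rule complex_poly_decompose_rsquarefree)
  have "degree (Polynomial.smult (lead_coeff ?P) (\<Prod>z | poly ?P z = 0. [:- z, 1:]))
      = card {z. poly ?P z = 0}"
    using lead jacobi_poly_nonzero[of b N] by (simp add: degree_prod_eq_sum_degree)
  then have "degree ?P = card {z. poly ?P z = 0}"
    unfolding eq .
  then have card: "card {z. poly ?P z = 0} = N"
    using deg by metis
  have "{z. poly ?P z = 0} = complex_of_real ` {x. poly ?p x = 0}"
  proof (intro equalityI subsetI)
    fix z assume "z \<in> {z. poly ?P z = 0}"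
    then have z: "poly ?P (of_real (Re z)) = 0" "z = of_real (Re z)"
      using real_root by fastforce+
    from z(1) have "poly ?p (Re z) = 0"
      by simp
    then show "z \<in> complex_of_real ` {x. poly ?p x = 0}"
      using z(2) by blast
  qed auto
  then have "card {z. poly ?P z = 0} = card {x. poly ?p x = 0}"
    by (simp add: card_image inj_on_def)
  with card show ?thesis by simp
qed simp

text \<open>The components of an eigenvector of the symmetric matrix are, up to the diagonal
  rescaling by \<^term>\<open>\<Prod>j<i. sqrt (b j)\<close>, the values of the polynomials.\<close>

lemma eigenvalue_jacobi_mat_iff:
  assumes N: "N > 0" and pos: "\<And>i. Suc i < N \<Longrightarrow> b i > 0"
  shows "eigenvalue (jacobi_mat b N) lam \<longleftrightarrow> poly (jacobi_poly b N) lam = 0"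
proof
  let ?p = "\<lambda>k. poly (jacobi_poly b k) lam"
  have row: "(jacobi_mat b N *\<^sub>v v) $ i =
      (if i = 0 then 0 else sqrt (b (i - 1)) * v $ (i - 1)) +
      (if Suc i < N then sqrt (b i) * v $ Suc i else 0)"
    if "v \<in> carrier_vec N" "i < N" for v i
  proof -
    have "(jacobi_mat b N *\<^sub>v v) $ i = (\<Sum>j<N.
        (if j = Suc i then sqrt (b i) else if i = Suc j then sqrt (b j) else 0) * v $ j)"
      using that by (auto simp: jacobi_mat_def scalar_prod_def lessThan_atLeast0 intro!: sum.cong)
    also have "\<dots> = (\<Sum>j<N. (if j = Suc i then sqrt (b i) * v $ j else 0) +
        (if i = Suc j then sqrt (b j) * v $ j else 0))"
      by (rule sum.cong) auto
    also have "\<dots> = (\<Sum>j<N. if j = Suc i then sqrt (b i) * v $ j else 0) +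
        (\<Sum>j<N. if i = Suc j then sqrt (b j) * v $ j else 0)"
      by (rule sum.distrib)
    also have "(\<Sum>j<N. if i = Suc j then sqrt (b j) * v $ j else 0) =
        (if i = 0 then 0 else sqrt (b (i - 1)) * v $ (i - 1))"
      using that by (cases i) auto
    also have "(\<Sum>j<N. if j = Suc i then sqrt (b i) * v $ j else 0) =
        (if Suc i < N then sqrt (b i) * v $ Suc i else 0)"
      by simp
    finally show ?thesis by simp
  qed
  {
    assume "eigenvalue (jacobi_mat b N) lam"
    then obtain v where v: "v \<in> carrier_vec N" "v \<noteq> 0\<^sub>v N"
      and eq: "jacobi_mat b N *\<^sub>v v = lam \<cdot>\<^sub>v v"
      by (auto simp: eigenvalue_def eigenvector_def jacobi_mat_def)
    define \<beta> where "\<beta> i = (\<Prod>j<i. sqrt (b j))" for i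
    have row': "lam * v $ i = (if i = 0 then 0 else sqrt (b (i - 1)) * v $ (i - 1)) +
      (if Suc i < N then sqrt (b i) * v $ Suc i else 0)" if "i < N" for i
      using row[OF v(1) that] v(1) that by (simp add: eq)
    have \<beta>_pos: "\<beta> i > 0" if "i < N" for i
      using that pos by (auto simp: \<beta>_def intro!: prod_pos)
    have ind: "i < N \<Longrightarrow> \<beta> i * v $ i = ?p i * v $ 0" for i
    proof (induction i rule: induct_nat_012)
      case 1
      then show ?case using row'[of 0] by (simp add: \<beta>_def)
    next
      case (ge2 i)
      have "lam * v $ Suc i = sqrt (b i) * v $ i + sqrt (b (Suc i)) * v $ Suc (Suc i)"
        using row'[of "Suc i"] ge2.prems by simp
      then have "\<beta> (Suc (Suc i)) * v $ Suc (Suc i)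
          = \<beta> (Suc i) * (lam * v $ Suc i - sqrt (b i) * v $ i)"
        by (simp add: \<beta>_def)
      also have "\<dots> = lam * (\<beta> (Suc i) * v $ Suc i) - (sqrt (b i))\<^sup>2 * (\<beta> i * v $ i)"
        by (simp add: \<beta>_def algebra_simps power2_eq_square)
      also have "\<dots> = ?p (Suc (Suc i)) * v $ 0"
        using ge2 pos[of i] by (simp add: algebra_simps)
      finally show ?case .
    qed (simp add: \<beta>_def)
    have v0: "v $ 0 \<noteq> 0"
    proof
      assume "v $ 0 = 0"
      then have "v $ i = 0" if "i < N" for i
        using ind[OF that] \<beta>_pos[OF that] by simp
      then show False
        using v by (metis carrier_vecD eq_vecI index_zero_vec)
    qed
    obtain k where k: "N = Suc k"
      using N by (cases N) auto
    show "?p N = 0"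
    \<comment> \<open>The last row has no entry to the right of the diagonal. After rescaling it
      says that the recurrence expression for p_N, evaluated at \<open>lam\<close>, is zero.\<close>
    proof (cases k)
      case 0
      then show ?thesis using row'[of 0] k v0 by simp
    next
      case (Suc l)
      have "lam * v $ k = sqrt (b l) * v $ l"
        using row'[of k] k Suc by simp
      then have "\<beta> k * (lam * v $ k) = \<beta> k * (sqrt (b l) * v $ l)"
        by (rule arg_cong)
      moreover have "\<beta> k = \<beta> l * sqrt (b l)"
        using Suc by (simp add: \<beta>_def)
      ultimately have "lam * (\<beta> k * v $ k) = (sqrt (b l))\<^sup>2 * (\<beta> l * v $ l)"
        by (simp only: power2_eq_square ac_simps)
      also have "(sqrt (b l))\<^sup>2 = b l"
        using pos[of l] k Suc by simp
      finally have "?p N * v $ 0 = 0"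
        using ind[of k] ind[of l] k Suc by (simp add: algebra_simps)
      then show ?thesis using v0 by simp
    qed
  next
    assume root: "?p N = 0"
    define v where "v = vec N (\<lambda>i. ?p i / (\<Prod>j<i. sqrt (b j)))"
    have v: "v \<in> carrier_vec N" "v \<noteq> 0\<^sub>v N"
      using N by (auto simp: v_def vec_eq_iff intro!: exI[of _ 0])
    have v_index: "v $ i = ?p i / (\<Prod>j<i. sqrt (b j))" if "i < N" for i
      using that by (simp add: v_def)
    have nz: "(\<Prod>j<i. sqrt (b j)) \<noteq> 0" if "i < N" for i
    proof -
      have "(\<Prod>j<i. sqrt (b j)) > 0"
        using that pos by (intro prod_pos) auto
      then show ?thesis by (metis less_irrefl)
    qed
    have "(jacobi_mat b N *\<^sub>v v) $ i = lam * v $ i" if i: "i < N" for i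
    proof (cases i)
      case 0
      show ?thesis
      proof (cases "N = 1")
        case True
        then show ?thesis using row[OF v(1) i] root 0 i by (simp add: v_index)
      next
        case False
        then show ?thesis using row[OF v(1) i] 0 i pos[of 0] by (simp add: v_index)
      qed
    next
      case (Suc l)
      have bl: "sqrt (b l) > 0"
        using pos[of l] i Suc by simp
      have pl: "sqrt (b l) * v $ l = b l * ?p l / (\<Prod>j<i. sqrt (b j))"
        using bl i Suc nz[of l] by (simp add: v_index field_simps)
      \<comment> \<open>In the last row the left side is 0 by default, and the right side is 0
        because \<open>lam\<close> is a root; all rows can then be treated alike.\<close>
      have sup: "(if Suc i < N then sqrt (b i) * v $ Suc i else 0) = ?p (Suc i) / (\<Prod>j<i. sqrt (b j))"
      proof (cases "Suc i < N")
        case True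
        then show ?thesis using pos[of i] by (simp add: v_index)
      next
        case False
        then have "Suc i = N" using i by simp
        then show ?thesis using root by simp
      qed
      show ?thesis
        unfolding row[OF v(1) i] sup using Suc pl i
        by (simp add: v_index add_divide_distrib diff_divide_distrib)
    qed
    then have "jacobi_mat b N *\<^sub>v v = lam \<cdot>\<^sub>v v"
      using v(1) by (intro eq_vecI) (auto simp: jacobi_mat_def)
    then show "eigenvalue (jacobi_mat b N) lam"
      using v by (auto simp: eigenvalue_def eigenvector_def jacobi_mat_def)
  }
qed

section \<open>Dimensions of direct sums\<close>

text \<open>If a new vector c lay in the span of B and C, its component from B would also lie in the
  span of \<open>insert c C\<close>, hence be 0, and c would depend on C alone.\<close>

lemma (in vector_space) independent_Un:
  assumes "independent B" "independent C" "finite C" "span B \<inter> span C \<subseteq> {0}"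
  shows "independent (B \<union> C)"
  using assms(3,2,4)
proof (induction C)
  case empty
  then show ?case using assms(1) by simp
next
  case (insert c C)
  have C: "independent C" "c \<notin> span C"
    using insert by (auto simp: independent_insert)
  have "span C \<subseteq> span (insert c C)"
    by (rule span_mono) auto
  then have indep: "independent (B \<union> C)"
    using insert C by blast
  have "c \<notin> span (B \<union> C)"
  proof
    assume "c \<in> span (B \<union> C)"
    then obtain x y where xy: "c = x + y" "x \<in> span B" "y \<in> span C"
      by (auto simp: span_Un)
    have "x = c - y"
      using xy by simp
    then have "x \<in> span (insert c C)"
      using xy(3) by (metis insertI1 span_base span_diff span_mono subset_insertI subsetD)
    then have "x = 0"
      using xy(2) insert.prems by blast
    then show False
      using xy C by simp
  qed
  then show ?case
    using indep by (simp add: independent_insertI)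
qed

text \<open>The ambient space may be infinite-dimensional, as the space of all functions on
  \<open>nat set\<close> is. The finite set S bounding both summands is what makes their bases
  finite.\<close>

lemma (in vector_space) dim_direct_sum:
  assumes A: "subspace A" "A \<subseteq> span S" and B: "subspace B" "B \<subseteq> span S"
    and S: "finite S" and AB: "A \<inter> B \<subseteq> {0}"
  shows "dim {a + b | a b. a \<in> A \<and> b \<in> B} = dim A + dim B"
proof -
  have basis: "\<exists>C. independent C \<and> finite C \<and> span C = X \<and> card C = dim X"
    if "subspace X" "X \<subseteq> span S" for X
  proof -
    obtain C where C: "C \<subseteq> X" "independent C" "X \<subseteq> span C" "card C = dim X"
      using basis_exists[of X] by metis
    have "finite C"
      using C that S independent_span_bound by (metis subset_trans)
    moreover have "span C = X"
      using C that span_subspace by blast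
    ultimately show ?thesis using C by blast
  qed
  obtain C where C: "independent C" "finite C" "span C = A" "card C = dim A"
    using basis[OF A] by blast
  obtain D where D: "independent D" "finite D" "span D = B" "card D = dim B"
    using basis[OF B] by blast
  have "C \<inter> D = {}"
  proof (rule ccontr)
    assume "C \<inter> D \<noteq> {}"
    then obtain x where x: "x \<in> C" "x \<in> D"
      by blast
    then have "x = 0"
      using C D AB span_base by blast
    then show False
      using x C dependent_zero by blast
  qed
  then have "card (C \<union> D) = dim A + dim B"
    using C D by (simp add: card_Un_disjoint)
  moreover have "independent (C \<union> D)"
    using independent_Un[of C D] C D AB by simp
  moreover have "span (C \<union> D) = {a + b | a b. a \<in> A \<and> b \<in> B}"
    by (simp add: span_Un C D)
  ultimately show ?thesis
    by (metis dim_span_eq_card_independent)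
qed

text \<open>Induction on the index set, splitting off one summand at a time. That the sum is a
  subspace is carried along because the two-summand case asks for it.\<close>

lemma (in vector_space) dim_direct_sum_family:
  assumes "finite T" and "finite S"
    and "\<And>t. t \<in> T \<Longrightarrow> subspace (A t)" "\<And>t. t \<in> T \<Longrightarrow> A t \<subseteq> span S"
    and "\<And>a. (\<And>t. t \<in> T \<Longrightarrow> a t \<in> A t) \<Longrightarrow> (\<Sum>t\<in>T. a t) = 0 \<Longrightarrow> \<forall>t\<in>T. a t = 0"
  shows "subspace {\<Sum>t\<in>T. a t | a. \<forall>t\<in>T. a t \<in> A t} \<and>
    dim {\<Sum>t\<in>T. a t | a. \<forall>t\<in>T. a t \<in> A t} = (\<Sum>t\<in>T. dim (A t))"
  using assms(1,3-)
proof (induction T)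
  case empty
  have "{\<Sum>t\<in>{}. a t |a. \<forall>t\<in>{}. a t \<in> A t} = {0}"
    by auto
  moreover have "dim {0} = 0"
    using dim_eq_card[OF _ independent_empty, of "{0}"] by simp
  ultimately show ?case by simp
next
  case (insert s T)
  let ?V = "\<lambda>T. {\<Sum>t\<in>T. a t | a. \<forall>t\<in>T. a t \<in> A t}"
  have indep: "\<forall>t\<in>T. a t = 0" if "\<And>t. t \<in> T \<Longrightarrow> a t \<in> A t" "(\<Sum>t\<in>T. a t) = 0" for a
  proof -
    \<comment> \<open>Padding with 0 at s turns a relation over T into one over the larger index
      set.\<close>
    have "\<forall>t\<in>insert s T. (a(s := 0)) t = 0"
    proof (rule insert.prems(3))
      fix t assume "t \<in> insert s T"
      then show "(a(s := 0)) t \<in> A t"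
        using that subspace_0[OF insert.prems(1)] by auto
    next
      have "sum (a(s := 0)) T = sum a T"
        using insert.hyps by (intro sum.cong) auto
      then show "sum (a(s := 0)) (insert s T) = 0"
        using insert.hyps that by simp
    qed
    then show ?thesis using insert.hyps by (metis fun_upd_other insertI2)
  qed
  have IH: "subspace (?V T)" "dim (?V T) = (\<Sum>t\<in>T. dim (A t))"
    using insert.IH insert.prems indep by blast+
  have eq: "?V (insert s T) = {a + b | a b. a \<in> A s \<and> b \<in> ?V T}"
  proof (intro equalityI subsetI)
    fix v assume "v \<in> ?V (insert s T)"
    then obtain a where "v = (\<Sum>t\<in>insert s T. a t)" "\<forall>t\<in>insert s T. a t \<in> A t"
      by blast
    then show "v \<in> {a + b | a b. a \<in> A s \<and> b \<in> ?V T}"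
      using insert.hyps by auto
  next
    fix v assume "v \<in> {a + b | a b. a \<in> A s \<and> b \<in> ?V T}"
    then obtain x a where v: "v = x + (\<Sum>t\<in>T. a t)" "x \<in> A s" "\<forall>t\<in>T. a t \<in> A t"
      by blast
    have "sum (a(s := x)) T = sum a T"
      using insert.hyps by (intro sum.cong) auto
    then have "v = sum (a(s := x)) (insert s T)"
      using v insert.hyps by simp
    moreover have "\<forall>t\<in>insert s T. (a(s := x)) t \<in> A t"
      using v by auto
    ultimately show "v \<in> ?V (insert s T)"
      by blast
  qed
  have "A s \<inter> ?V T \<subseteq> {0}"
  proof
    fix v assume "v \<in> A s \<inter> ?V T"
    then obtain a where v: "v \<in> A s" "v = sum a T" "\<forall>t\<in>T. a t \<in> A t"
      by blast
    \<comment> \<open>A common vector v, written as a sum over T, is cancelled by the entry -v at s;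
      independence then gives v = 0.\<close>
    have "\<forall>t\<in>insert s T. (a(s := - v)) t = 0"
    proof (rule insert.prems(3))
      fix t assume "t \<in> insert s T"
      then show "(a(s := - v)) t \<in> A t"
        using v subspace_neg[OF insert.prems(1)] by auto
    next
      have "sum (a(s := - v)) T = sum a T"
        using insert.hyps by (intro sum.cong) auto
      then show "sum (a(s := - v)) (insert s T) = 0"
        using insert.hyps v by simp
    qed
    then show "v \<in> {0}" by auto
  qed
  moreover have "?V T \<subseteq> span S"
    using insert.prems(2) by (auto intro!: span_sum)
  ultimately have "dim (?V (insert s T)) = dim (A s) + dim (?V T)"
    unfolding eq using insert.prems(1,2) IH assms(2) by (intro dim_direct_sum) auto
  moreover have "subspace (?V (insert s T))"
    unfolding eq using subspace_sums[OF _ IH(1), of "A s"] insert.prems(1) by simp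
  ultimately show ?case
    using IH insert.hyps by simp
qed

lemma (in vector_space_pair) dim_image_inj_on:
  assumes f: "Vector_Spaces.linear s1 s2 f" and A: "vs1.subspace A" and inj: "inj_on f A"
  shows "vs2.dim (f ` A) = vs1.dim A"
proof -
  obtain B where B: "B \<subseteq> A" "vs1.independent B" "A \<subseteq> vs1.span B" "card B = vs1.dim A"
    using vs1.basis_exists[of A] by metis
  have span: "vs1.span B = A"
    using B A vs1.span_subspace by blast
  interpret f: Vector_Spaces.linear s1 s2 f by fact
  have "vs2.independent (f ` B)"
    using f.independent_injective_image B inj span by simp
  moreover have "vs2.span (f ` B) = f ` A"
    by (simp add: f.span_image span)
  moreover have "card (f ` B) = card B"
    using inj B by (meson card_image inj_on_subset)
  ultimately show ?thesis
    using vs2.dim_span_eq_card_independent B by metis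
qed

section \<open>Raising, lowering and harmonic functions\<close>

interpretation fvs: vector_space fscale
  by unfold_locales (auto simp: fscale_def fun_eq_iff algebra_simps)

interpretation fvp: vector_space_pair fscale fscale ..

abbreviation flinear :: "((nat set \<Rightarrow> real) \<Rightarrow> (nat set \<Rightarrow> real)) \<Rightarrow> bool" where
  "flinear \<equiv> Vector_Spaces.linear fscale fscale"

lemma fscale_apply: "fscale c f x = c * f x"
  by (simp add: fscale_def)

lemma sum_fun_apply: "(\<Sum>a\<in>A. F a) x = (\<Sum>a\<in>A. F a x)"
  for F :: "'a \<Rightarrow> 'b \<Rightarrow> 'c :: comm_monoid_add"
  by (induction A rule: infinite_finite_induct) auto

text \<open>The induction method leaves \<open>\<eta>\<close>-expanded terms, in which these rules would unfold
  the operations on functions everywhere.\<close>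

lemmas fun_apply = fscale_apply sum_fun_apply plus_fun_apply zero_fun_apply minus_apply uminus_apply

declare plus_fun_apply [simp del] zero_fun_apply [simp del] minus_apply [simp del]
  uminus_apply [simp del]

lemma flinearI:
  assumes "\<And>f g. F (f + g) = F f + F g" "\<And>c f. F (fscale c f) = fscale c (F f)"
  shows "flinear F"
  using assms by unfold_locales

lemma
  assumes "flinear F"
  shows flinear_sum: "F (\<Sum>a\<in>A. v a) = (\<Sum>a\<in>A. F (v a))"
    and flinear_fscale: "F (fscale c f) = fscale c (F f)"
    and flinear_add: "F (f + g) = F f + F g"
    and flinear_diff: "F (f - g) = F f - F g"
    and flinear_zero: "F 0 = 0"
proof -
  interpret F: Vector_Spaces.linear fscale fscale F by fact
  show "F (\<Sum>a\<in>A. v a) = (\<Sum>a\<in>A. F (v a))" by (rule F.sum)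
  show "F (fscale c f) = fscale c (F f)" by (rule F.scale)
  show "F (f + g) = F f + F g" by (rule F.add)
  show "F (f - g) = F f - F g" by (rule F.diff)
  show "F 0 = 0" by (rule F.zero)
qed

lemma flinear_funpow:
  assumes "flinear F"
  shows "flinear (F ^^ k)"
proof (induction k)
  case (Suc k)
  show ?case
    by (rule flinearI) (simp_all only: funpow.simps comp_apply flinear_add[OF Suc]
      flinear_fscale[OF Suc] flinear_add[OF assms] flinear_fscale[OF assms])
qed (auto intro!: flinearI)

lemma finite_layer [simp]: "finite (layer n i)"
  by (rule finite_subset[of _ "Pow {1..n}"]) (auto simp: layer_def)

lemma card_layer: "card (layer n i) = n choose i"
  using n_subsets[of "{1..n}" i] by (simp add: layer_def)

section \<open>Functions supported on a finite set of points\<close>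

lemma subspace_funs_on: "fsubspace (funs_on X)"
  by (auto simp: fvs.subspace_def funs_on_def fun_apply)

lemma funs_on_expand:
  assumes "finite X" "f \<in> funs_on X"
  shows "f = (\<Sum>z\<in>X. fscale (f z) (indicator {z}))"
proof
  fix x
  have "(\<Sum>z\<in>X. f z * indicator {z} x) = (\<Sum>z\<in>X. if z = x then f z else 0)"
    by (intro sum.cong) (auto simp: indicator_def)
  then show "f x = (\<Sum>z\<in>X. fscale (f z) (indicator {z})) x"
    using assms by (auto simp: funs_on_def fun_apply)
qed

lemma funs_on_eq_span:
  assumes "finite X"
  shows "funs_on X = fspan ((\<lambda>z. indicator {z}) ` X)"
proof (intro equalityI subsetI)
  fix f assume "f \<in> funs_on X"
  then have "f = (\<Sum>z\<in>X. fscale (f z) (indicator {z}))"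
    by (rule funs_on_expand[OF assms])
  also have "\<dots> \<in> fspan ((\<lambda>z. indicator {z}) ` X)"
    by (intro fvs.span_sum fvs.span_scale fvs.span_base) auto
  finally show "f \<in> fspan ((\<lambda>z. indicator {z}) ` X)" .
next
  have "fspan ((\<lambda>z. indicator {z}) ` X) \<subseteq> funs_on X"
    by (intro fvs.span_minimal subspace_funs_on) (auto simp: funs_on_def indicator_def)
  then show "f \<in> funs_on X" if "f \<in> fspan ((\<lambda>z. indicator {z}) ` X)" for f
    using that by blast
qed

lemma fdim_funs_on:
  assumes "finite X"
  shows "fdim (funs_on X) = card X"
proof -
  let ?\<delta> = "\<lambda>z :: nat set. (indicator {z} :: nat set \<Rightarrow> real)"
  have inj: "inj ?\<delta>"
    by (rule injI) (metis indicator_eq_1_iff singleton_iff singletonI)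
  have indep: "fvs.independent (?\<delta> ` X)"
    using assms
  proof (induction X)
    case (insert x X)
    have "?\<delta> x \<notin> funs_on X"
      using insert.hyps by (auto simp: funs_on_def intro!: exI[of _ x])
    then show ?case
      using insert by (simp add: fvs.independent_insertI funs_on_eq_span)
  qed (simp add: fvs.independent_empty)
  have "fdim (funs_on X) = card (?\<delta> ` X)"
    using fvs.dim_span_eq_card_independent[OF indep] funs_on_eq_span[OF assms] by simp
  also have "\<dots> = card X"
    using inj by (intro card_image) (auto intro: inj_on_subset)
  finally show ?thesis .
qed

section \<open>Raising and lowering operators and their commutation relation\<close>

definition up :: "nat \<Rightarrow> (nat set \<Rightarrow> real) \<Rightarrow> (nat set \<Rightarrow> real)" where
  "up n f = (\<lambda>x. if x \<subseteq> {1..n} then \<Sum>i\<in>x. f (x - {i}) else 0)"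

text \<open>Like \<open>up\<close>, this acts on functions on the whole cube. The layer appears only
  in support conditions, so a single operator can be iterated with \<open>^^\<close> instead of
  composing a family indexed by layers.\<close>

definition dn :: "nat \<Rightarrow> (nat set \<Rightarrow> real) \<Rightarrow> (nat set \<Rightarrow> real)" where
  "dn n f = (\<lambda>x. if x \<subseteq> {1..n} then \<Sum>i\<in>{1..n} - x. f (insert i x) else 0)"

definition harm :: "nat \<Rightarrow> nat \<Rightarrow> (nat set \<Rightarrow> real) set" where
  "harm n t = {h \<in> funs_on (layer n t). dn n h = 0}"

lemma flinear_up: "flinear (up n)"
  by (rule flinearI) (auto simp: up_def fun_apply fun_eq_iff sum.distrib sum_distrib_left)

lemma flinear_dn: "flinear (dn n)"
  by (rule flinearI) (auto simp: dn_def fun_apply fun_eq_iff sum.distrib sum_distrib_left)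

lemmas up_simps = flinear_sum[OF flinear_up] flinear_fscale[OF flinear_up]
  flinear_add[OF flinear_up] flinear_diff[OF flinear_up] flinear_zero[OF flinear_up]

lemmas dn_simps = flinear_sum[OF flinear_dn] flinear_fscale[OF flinear_dn]
  flinear_add[OF flinear_dn] flinear_diff[OF flinear_dn] flinear_zero[OF flinear_dn]

lemmas flinear_up_funpow = flinear_funpow[OF flinear_up]

lemmas up_funpow_simps = flinear_sum[OF flinear_up_funpow] flinear_fscale[OF flinear_up_funpow]
  flinear_add[OF flinear_up_funpow] flinear_diff[OF flinear_up_funpow]
  flinear_zero[OF flinear_up_funpow]

lemma up_funs_on:
  assumes "f \<in> funs_on (layer n i)"
  shows "up n f \<in> funs_on (layer n (Suc i))"
proof -
  have "up n f x = 0" if "x \<notin> layer n (Suc i)" for x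
  proof (cases "x \<subseteq> {1..n}")
    case True
    then have "finite x" by (rule finite_subset) simp
    then have "f (x - {j}) = 0" if "j \<in> x" for j
      using that \<open>x \<notin> _\<close> True assms card_Suc_Diff1[of x j] by (auto simp: funs_on_def layer_def)
    then show ?thesis by (simp add: up_def)
  qed (simp add: up_def)
  then show ?thesis by (simp add: funs_on_def)
qed

lemma dn_funs_on:
  assumes "f \<in> funs_on (layer n (Suc i))"
  shows "dn n f \<in> funs_on (layer n i)"
proof -
  have "dn n f x = 0" if "x \<notin> layer n i" for x
  proof (cases "x \<subseteq> {1..n}")
    case True
    then have "finite x" by (rule finite_subset) simp
    then have "f (insert j x) = 0" if "j \<in> {1..n} - x" for j
      using that \<open>x \<notin> _\<close> True assms by (auto simp: funs_on_def layer_def)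
    then show ?thesis by (simp add: dn_def)
  qed (simp add: dn_def)
  then show ?thesis by (simp add: funs_on_def)
qed

lemma dn_layer_0:
  assumes "f \<in> funs_on (layer n 0)"
  shows "dn n f = 0"
proof
  fix x
  have "f (insert j x) = 0" if "x \<subseteq> {1..n}" for j
  proof -
    have "insert j x \<notin> layer n 0"
      using finite_subset[OF that] by (simp add: layer_def)
    then show ?thesis using assms by (simp add: funs_on_def)
  qed
  then show "dn n f x = 0 x"
    by (simp add: dn_def fun_apply)
qed

lemma up_funpow_funs_on:
  "f \<in> funs_on (layer n i) \<Longrightarrow> (up n ^^ k) f \<in> funs_on (layer n (i + k))"
  by (induction k) (auto intro: up_funs_on)

text \<open>Adding and removing two different elements commutes, so these terms (\<open>?S\<close>
  below) cancel. What remains are the round trips to x: one for each of the n - |x| elements outside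
  x in \<open>dn\<close> after \<open>up\<close>, and one for each of the |x| elements inside in the
  other order.\<close>

lemma dn_up_commutator:
  assumes "f \<in> funs_on (layer n i)"
  shows "dn n (up n f) = up n (dn n f) + fscale (real n - 2 * real i) f"
proof
  fix x
  show "dn n (up n f) x = (up n (dn n f) + fscale (real n - 2 * real i) f) x"
  proof (cases "x \<subseteq> {1..n}")
    case False
    then have "f x = 0"
      using assms by (auto simp: funs_on_def layer_def)
    then show ?thesis using False by (simp add: up_def dn_def fun_apply)
  next
    case x: True
    then have fin: "finite x" by (rule finite_subset) simp
    let ?c = "{1..n} - x"
    let ?S = "\<Sum>j\<in>x. \<Sum>i\<in>?c. f (insert i (x - {j}))"
    have "dn n (up n f) x = (\<Sum>i\<in>?c. up n f (insert i x))"
      using x by (simp add: dn_def)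
    also have "\<dots> = (\<Sum>i\<in>?c. f x + (\<Sum>j\<in>x. f (insert i (x - {j}))))"
    proof (rule sum.cong)
      fix i assume i: "i \<in> ?c"
      have "up n f (insert i x) = f (insert i x - {i}) + (\<Sum>j\<in>x. f (insert i x - {j}))"
        using i x fin by (simp add: up_def)
      also have "(\<Sum>j\<in>x. f (insert i x - {j})) = (\<Sum>j\<in>x. f (insert i (x - {j})))"
        using i by (intro sum.cong) (auto intro!: arg_cong[of _ _ f])
      also have "insert i x - {i} = x"
        using i by auto
      finally show "up n f (insert i x) = f x + (\<Sum>j\<in>x. f (insert i (x - {j})))" .
    qed simp
    also have "\<dots> = card ?c * f x + ?S"
      by (simp add: sum.distrib) (rule sum.swap)
    also have "real (card ?c) = real n - real (card x)"
      using x fin by (simp add: card_Diff_subset of_nat_diff card_mono[of "{1..n}", simplified])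
    finally have 1: "dn n (up n f) x = (real n - real (card x)) * f x + ?S" .
    have "up n (dn n f) x = (\<Sum>j\<in>x. dn n f (x - {j}))"
      using x by (simp add: up_def)
    also have "\<dots> = (\<Sum>j\<in>x. f x + (\<Sum>i\<in>?c. f (insert i (x - {j}))))"
    proof (rule sum.cong)
      fix j assume j: "j \<in> x"
      have "{1..n} - (x - {j}) = insert j ?c" "x - {j} \<subseteq> {1..n}"
        using j x by auto
      then show "dn n f (x - {j}) = f x + (\<Sum>i\<in>?c. f (insert i (x - {j})))"
        using j by (simp add: dn_def insert_absorb)
    qed simp
    also have "\<dots> = card x * f x + ?S"
      by (simp add: sum.distrib)
    finally have 2: "up n (dn n f) x = card x * f x + ?S" .
    have "f x = 0" if "card x \<noteq> i"
      using that assms by (auto simp: funs_on_def layer_def)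
    then show ?thesis
      using 1 2 by (cases "card x = i") (auto simp: fun_apply algebra_simps)
  qed
qed

text \<open>Each commutation past an \<open>up\<close> adds n - 2(t+r), where t+r is the current
  layer, and the last term vanishes because h is harmonic. These arithmetic progressions sum to the
  numbers \<open>lamk\<close>.\<close>

lemma dn_up_funpow:
  assumes "h \<in> harm n t"
  shows "dn n ((up n ^^ Suc s) h) = fscale (lamk n t (Suc (Suc s))) ((up n ^^ s) h)"
proof (induction s)
  case 0
  show ?case
    using assms dn_up_commutator[of h n t]
    by (auto simp: harm_def lamk_def up_simps)
next
  case (Suc s)
  have "(up n ^^ Suc s) h \<in> funs_on (layer n (t + Suc s))"
    using assms by (intro up_funpow_funs_on) (simp add: harm_def)
  then have "dn n ((up n ^^ Suc (Suc s)) h) =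
      up n (dn n ((up n ^^ Suc s) h)) + fscale (real n - 2 * real (t + Suc s)) ((up n ^^ Suc s) h)"
    by (simp add: dn_up_commutator)
  also have "up n (dn n ((up n ^^ Suc s) h)) = fscale (lamk n t (Suc (Suc s))) ((up n ^^ Suc s) h)"
    by (simp add: Suc.IH up_simps del: funpow.simps) simp
  also have "\<dots> + fscale (real n - 2 * real (t + Suc s)) ((up n ^^ Suc s) h)
      = fscale (lamk n t (Suc (Suc (Suc s)))) ((up n ^^ Suc s) h)"
    unfolding fvs.scale_left_distrib[symmetric]
    by (intro arg_cong2[of _ _ _ _ fscale]) (auto simp: lamk_def algebra_simps)
  finally show ?case .
qed

text \<open>The bounds give n - 2t >= 2k, so the second factor of \<open>lamk n t (Suc k)\<close> is
  at least k+1. Staying in the lower half of the cube enters the invertibility arguments through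
  this positivity.\<close>

lemma lamk_pos:
  assumes "t + k \<le> i" "2 * i \<le> n" "k > 0"
  shows "lamk n t (Suc k) > 0"
proof -
  have "real (t + k) \<le> real i" "real (2 * i) \<le> real n"
    using assms by (auto simp only: of_nat_le_iff)
  then show ?thesis
    using assms by (auto simp: lamk_def intro!: mult_pos_pos)
qed

section \<open>Harmonic functions and the decomposition of a layer\<close>

lemma subspace_harm: "fsubspace (harm n t)"
  using subspace_funs_on[of "layer n t"]
  by (auto simp: harm_def fvs.subspace_def dn_simps)

lemma harm_simps:
  "0 \<in> harm n t" "h \<in> harm n t \<Longrightarrow> fscale c h \<in> harm n t"
  "h \<in> harm n t \<Longrightarrow> h' \<in> harm n t \<Longrightarrow> h + h' \<in> harm n t"
  "h \<in> harm n t \<Longrightarrow> h' \<in> harm n t \<Longrightarrow> h - h' \<in> harm n t"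
  using subspace_harm[of n t] fvs.subspace_diff[OF subspace_harm]
  by (auto simp: fvs.subspace_def)

text \<open>Each \<^term>\<open>up n ^^ (i - t)\<close> of a harmonic function is an eigenvector of
  \<^term>\<open>dn n \<circ> up n\<close> with non-zero eigenvalue, so the equation \<^prop>\<open>dn n (up n g) = dn n f\<close> is
  solved summand by summand.\<close>

lemma layer_decomposition:
  assumes "2 * i \<le> n" "f \<in> funs_on (layer n i)"
  shows "\<exists>h. (\<forall>t. h t \<in> harm n t) \<and> f = (\<Sum>t\<le>i. (up n ^^ (i - t)) (h t))"
  using assms
proof (induction i arbitrary: f)
  case 0
  then have "f \<in> harm n 0"
    by (simp add: harm_def dn_layer_0)
  then show ?case
    by (intro exI[of _ "\<lambda>t. if t = 0 then f else 0"]) (auto simp: harm_simps)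
next
  case (Suc i)
  obtain h where h: "\<And>t. h t \<in> harm n t" "dn n f = (\<Sum>t\<le>i. (up n ^^ (i - t)) (h t))"
    using Suc.IH[of "dn n f"] dn_funs_on[OF Suc.prems(2)] Suc.prems(1) by auto
  define g where "g t = fscale (inverse (lamk n t (Suc (Suc (i - t))))) (h t)" for t
  have g: "g t \<in> harm n t" for t
    by (simp add: g_def h harm_simps)
  \<comment> \<open>By the choice of g the remainder is annihilated by \<open>dn\<close>; it is the
    new component, of degree \<open>Suc i\<close>.\<close>
  define r where "r = f - (\<Sum>t\<le>i. (up n ^^ (Suc i - t)) (g t))"
  have "dn n ((up n ^^ (Suc i - t)) (g t)) = (up n ^^ (i - t)) (h t)" if "t \<le> i" for t
  proof -
    have "lamk n t (Suc (Suc (i - t))) \<noteq> 0"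
      using lamk_pos[of t "Suc (i - t)" "Suc i" n] that Suc.prems by simp
    moreover have "dn n ((up n ^^ Suc (i - t)) (g t))
        = fscale (lamk n t (Suc (Suc (i - t)))) ((up n ^^ (i - t)) (g t))"
      by (rule dn_up_funpow[OF g])
    ultimately show ?thesis
      using that by (simp add: g_def up_funpow_simps Suc_diff_le)
  qed
  then have "dn n r = 0"
    by (simp add: r_def dn_simps h)
  moreover have "(\<Sum>t\<le>i. (up n ^^ (Suc i - t)) (g t)) \<in> funs_on (layer n (Suc i))"
  proof (intro fvs.subspace_sum[OF subspace_funs_on])
    fix t assume "t \<in> {..i}"
    then show "(up n ^^ (Suc i - t)) (g t) \<in> funs_on (layer n (Suc i))"
      using up_funpow_funs_on[of "g t" n t "Suc i - t"] g[of t] by (simp add: harm_def)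
  qed
  then have "r \<in> funs_on (layer n (Suc i))"
    using fvs.subspace_diff[OF subspace_funs_on] Suc.prems by (simp add: r_def)
  ultimately have r: "r \<in> harm n (Suc i)"
    by (simp add: harm_def)
  have "f = (\<Sum>t\<le>Suc i. (up n ^^ (Suc i - t)) ((g(Suc i := r)) t))"
    by (simp add: r_def)
  moreover have "(g(Suc i := r)) t \<in> harm n t" for t
    using r g by simp
  ultimately show ?case
    by blast
qed

text \<open>Applying \<open>dn\<close> kills the component of top degree and moves the relation one
  layer down, multiplying every other component by a non-zero number. The induction hypothesis
  removes those, and the top component is then left alone.\<close>

lemma layer_decomposition_unique:
  assumes "2 * i \<le> n" "\<And>t. t \<le> i \<Longrightarrow> h t \<in> harm n t"
    and "(\<Sum>t\<le>i. (up n ^^ (i - t)) (h t)) = 0"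
  shows "t \<le> i \<Longrightarrow> h t = 0"
  using assms
proof (induction i arbitrary: h t)
  case (Suc i)
  have low: "h t = 0" if t: "t \<le> i" for t
  proof -
    let ?c = "\<lambda>t. lamk n t (Suc (Suc (i - t)))"
    have "dn n ((up n ^^ (Suc i - s)) (h s)) = (up n ^^ (i - s)) (fscale (?c s) (h s))"
      if "s \<le> i" for s
      using dn_up_funpow[of "h s" n s "i - s"] Suc.prems(3)[of s] that
      by (simp add: up_funpow_simps Suc_diff_le)
    then have "(\<Sum>s\<le>i. (up n ^^ (i - s)) (fscale (?c s) (h s)))
        = dn n (\<Sum>s\<le>i. (up n ^^ (Suc i - s)) (h s))"
      by (simp add: dn_simps)
    also have "(\<Sum>s\<le>i. (up n ^^ (Suc i - s)) (h s)) = - h (Suc i)"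
      using Suc.prems(4) by (simp add: eq_neg_iff_add_eq_0)
    also have "dn n (- h (Suc i)) = 0"
      using Suc.prems(3)[of "Suc i"] flinear_diff[OF flinear_dn, of n 0 "h (Suc i)"]
      by (simp add: harm_def dn_simps)
    finally have eq: "(\<Sum>s\<le>i. (up n ^^ (i - s)) (fscale (?c s) (h s))) = 0" .
    have "fscale (?c t) (h t) = 0"
      by (rule Suc.IH[of t "\<lambda>s. fscale (?c s) (h s)", OF t])
        (use eq Suc.prems in \<open>auto simp: harm_simps\<close>)
    moreover have "?c t \<noteq> 0"
      using lamk_pos[of t "Suc (i - t)" "Suc i" n] t Suc.prems by simp
    ultimately show ?thesis
      by simp
  qed
  then have "h (Suc i) = 0"
    using Suc.prems(4) by (simp add: up_funpow_simps)
  with low show ?case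
    using Suc.prems(1) by (cases "t = Suc i") auto
qed simp

lemma up_funpow_harm_eq_0D:
  assumes "t + k \<le> i" "2 * i \<le> n" "h \<in> harm n t" "(up n ^^ k) h = 0"
  shows "h = 0"
proof -
  let ?h = "\<lambda>s. if s = t then h else 0"
  have "(\<Sum>s\<le>t + k. (up n ^^ (t + k - s)) (?h s)) = (\<Sum>s\<in>{t}. (up n ^^ (t + k - s)) (?h s))"
    by (rule sum.mono_neutral_right) (auto simp: flinear_zero[OF flinear_up_funpow])
  also have "\<dots> = 0"
    using assms(4) by simp
  finally have eq: "(\<Sum>s\<le>t + k. (up n ^^ (t + k - s)) (?h s)) = 0" .
  have "?h s \<in> harm n s" for s
    using assms(3) harm_simps(1)[of n s] by simp
  then have "?h t = 0"
    using assms(1,2) eq layer_decomposition_unique[of "t + k" n ?h t] by simp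
  then show ?thesis by simp
qed

lemma inj_on_up_funpow_harm:
  assumes "t + k \<le> i" "2 * i \<le> n"
  shows "inj_on (up n ^^ k) (harm n t)"
proof (rule inj_onI)
  fix f g assume "f \<in> harm n t" "g \<in> harm n t" "(up n ^^ k) f = (up n ^^ k) g"
  then have "f - g \<in> harm n t" "(up n ^^ k) (f - g) = 0"
    by (auto simp: harm_simps up_funpow_simps)
  then have "f - g = 0"
    by (rule up_funpow_harm_eq_0D[OF assms])
  then show "f = g" by simp
qed

text \<open>Raising leaves the harmonic components as they are and only increases the exponents,
  with 0 as the component of degree \<open>Suc i\<close>. Uniqueness one layer higher therefore
  applies.\<close>

lemma inj_on_up_layer:
  assumes "2 * Suc i \<le> n"
  shows "inj_on (up n) (funs_on (layer n i))"
proof (rule inj_onI)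
  fix f g assume fg: "f \<in> funs_on (layer n i)" "g \<in> funs_on (layer n i)" "up n f = up n g"
  then have "f - g \<in> funs_on (layer n i)"
    using fvs.subspace_diff[OF subspace_funs_on] by blast
  then obtain h where h: "\<And>t. h t \<in> harm n t" "f - g = (\<Sum>t\<le>i. (up n ^^ (i - t)) (h t))"
    using layer_decomposition[of i n "f - g"] assms by auto
  let ?h = "h(Suc i := 0)"
  have "(\<Sum>t\<le>Suc i. (up n ^^ (Suc i - t)) (?h t)) = (\<Sum>t\<le>i. up n ((up n ^^ (i - t)) (h t)))"
    by (simp add: Suc_diff_le up_funpow_simps up_simps)
  also have "\<dots> = up n (f - g)"
    by (simp add: up_simps h(2))
  also have "\<dots> = 0"
    using fg by (simp add: up_simps)
  finally have eq: "(\<Sum>t\<le>Suc i. (up n ^^ (Suc i - t)) (?h t)) = 0" .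
  have "?h t = 0" if "t \<le> Suc i" for t
    by (rule layer_decomposition_unique[of "Suc i" n ?h t])
      (use that assms h eq in \<open>auto simp: harm_simps\<close>)
  then have "h t = 0" if "t \<le> i" for t
    using that by (metis fun_upd_apply le_SucI not_less_eq_eq)
  then have "f - g = 0"
    by (simp add: h(2) up_funpow_simps)
  then show "f = g" by simp
qed

text \<open>Layer t is the direct sum of \<open>harm n t\<close> and the image of layer t-1 under
  \<open>up\<close>, on which \<open>up\<close> is injective. The dimension is thus the difference
  of two layer sizes.\<close>

lemma fdim_harm:
  assumes "2 * t \<le> n"
  shows "int (fdim (harm n t)) = multt n t"
proof (cases t)
  case 0
  have "harm n 0 = funs_on (layer n 0)"
    by (auto simp: harm_def dn_layer_0)
  then show ?thesis
    by (simp add: 0 multt_def fdim_funs_on card_layer)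
next
  case (Suc s)
  let ?F = "\<lambda>i. funs_on (layer n i)"
  have span: "?F t \<subseteq> fspan ((\<lambda>z. indicator {z}) ` layer n t)"
    by (simp add: funs_on_eq_span)
  have up: "up n ` ?F s \<subseteq> ?F t"
    using Suc by (auto intro: up_funs_on)
  have harm: "harm n t \<subseteq> ?F t"
    by (auto simp: harm_def)
  have sum: "?F t = {a + b | a b. a \<in> harm n t \<and> b \<in> up n ` ?F s}"
  proof (intro equalityI subsetI)
    fix f assume "f \<in> ?F t"
    then obtain h where h: "\<And>t. h t \<in> harm n t" "f = (\<Sum>r\<le>t. (up n ^^ (t - r)) (h r))"
      using layer_decomposition[of t n f] assms by auto
    have "(\<Sum>r\<le>s. (up n ^^ (s - r)) (h r)) \<in> ?F s"
    proof (intro fvs.subspace_sum[OF subspace_funs_on])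
      fix r assume "r \<in> {..s}"
      then show "(up n ^^ (s - r)) (h r) \<in> ?F s"
        using up_funpow_funs_on[of "h r" n r "s - r"] h(1)[of r] by (simp add: harm_def)
    qed
    moreover have "f = h t + up n (\<Sum>r\<le>s. (up n ^^ (s - r)) (h r))"
      by (simp add: h(2) Suc up_simps Suc_diff_le)
    ultimately show "f \<in> {a + b | a b. a \<in> harm n t \<and> b \<in> up n ` ?F s}"
      using h(1) by blast
  next
    fix f assume "f \<in> {a + b | a b. a \<in> harm n t \<and> b \<in> up n ` ?F s}"
    then show "f \<in> ?F t"
      using harm up fvs.subspace_add[OF subspace_funs_on] by blast
  qed
  have "harm n t \<inter> up n ` ?F s \<subseteq> {0}"
  proof
    fix f assume "f \<in> harm n t \<inter> up n ` ?F s"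
    then obtain g where g: "f \<in> harm n t" "f = up n g" "g \<in> ?F s"
      by blast
    obtain h where h: "\<And>t. h t \<in> harm n t" "g = (\<Sum>r\<le>s. (up n ^^ (s - r)) (h r))"
      using layer_decomposition[of s n g] g assms Suc by auto
    \<comment> \<open>A common element f is entered with a minus sign as the component of degree t,
      so that uniqueness forces it to be 0.\<close>
    have "(\<Sum>r\<le>t. (up n ^^ (t - r)) ((h(t := - f)) r)) = up n g - f"
      by (simp add: h(2) Suc up_simps Suc_diff_le)
    then have eq: "(\<Sum>r\<le>t. (up n ^^ (t - r)) ((h(t := - f)) r)) = 0"
      using g by simp
    have "(h(t := - f)) t = 0"
      by (rule layer_decomposition_unique[of t n "h(t := - f)" t])
        (use assms h(1) g(1) harm_simps(4)[of 0 n t f] eq in \<open>auto simp: harm_simps\<close>)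
    then show "f \<in> {0}" by simp
  qed
  moreover have "fsubspace (up n ` ?F s)"
  proof -
    interpret up: Vector_Spaces.linear fscale fscale "up n" by (rule flinear_up)
    show ?thesis by (rule up.subspace_image[OF subspace_funs_on])
  qed
  ultimately have "fdim (?F t) = fdim (harm n t) + fdim (up n ` ?F s)"
    unfolding sum using span harm up subspace_harm
    by (intro fvs.dim_direct_sum[where S = "(\<lambda>z. indicator {z}) ` layer n t"]) auto
  moreover have "fdim (up n ` ?F s) = fdim (?F s)"
    using fvp.dim_image_inj_on[OF flinear_up subspace_funs_on inj_on_up_layer] assms Suc by simp
  ultimately show ?thesis
    by (simp add: fdim_funs_on card_layer multt_def Suc)
qed

lemma multt_pos:
  assumes "2 * t \<le> n"
  shows "multt n t > 0"
  using assms binomial_strict_mono[of "t - 1" t n] by (cases t) (auto simp: multt_def)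

section \<open>The eigenspaces of a layer\<close>

text \<open>Summing over the whole cube frees the form from the layer, so that the adjointness of
  \<open>up\<close> and \<open>dn\<close>, which change layers, can be stated. On functions
  supported in one layer it is the inner product of that layer.\<close>

definition ip :: "nat \<Rightarrow> (nat set \<Rightarrow> real) \<Rightarrow> (nat set \<Rightarrow> real) \<Rightarrow> real" where
  "ip n f g = (\<Sum>x\<in>Pow {1..n}. f x * g x)"

lemma ip_layer:
  assumes "f \<in> funs_on (layer n i)"
  shows "(\<Sum>x\<in>layer n i. f x * g x) = ip n f g"
  unfolding ip_def using assms
  by (intro sum.mono_neutral_left) (auto simp: layer_def funs_on_def)

lemma ip_commute: "ip n f g = ip n g f"
  by (simp add: ip_def mult.commute)

lemma ip_add_left: "ip n (f + g) h = ip n f h + ip n g h"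
  by (simp add: ip_def fun_apply algebra_simps sum.distrib)

lemma ip_sum_right: "ip n f (\<Sum>a\<in>A. F a) = (\<Sum>a\<in>A. ip n f (F a))"
  unfolding ip_def fun_apply sum_distrib_left by (rule sum.swap)

lemma ip_zero_left: "ip n 0 f = 0"
  by (simp add: ip_def fun_apply)

lemma ip_self_eq_0:
  assumes "f \<in> funs_on (layer n i)" "ip n f f = 0"
  shows "f = 0"
proof
  fix x
  have "\<forall>x\<in>Pow {1..n}. f x * f x = 0"
    using assms(2) by (subst (asm) ip_def, subst (asm) sum_nonneg_eq_0_iff) auto
  moreover have "f x = 0" if "x \<notin> Pow {1..n}"
    using that assms(1) by (auto simp: funs_on_def layer_def)
  ultimately show "f x = 0 x"
    by (auto simp: fun_apply)
qed

text \<open>Both sides sum over the edges of the cube, indexed on the left by the upper endpoint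
  with the element to remove, on the right by the lower endpoint with the element to add.\<close>

lemma ip_up_left: "ip n (up n f) g = ip n f (dn n g)"
proof -
  have fin: "finite x" if "x \<subseteq> {1..n}" for x
    using that by (rule finite_subset) simp
  have "ip n (up n f) g = (\<Sum>x\<in>Pow {1..n}. \<Sum>i\<in>x. f (x - {i}) * g x)"
    by (simp add: ip_def up_def sum_distrib_right)
  also have "\<dots> = (\<Sum>(x, i)\<in>Sigma (Pow {1..n}) (\<lambda>x. x). f (x - {i}) * g x)"
    using fin by (subst sum.Sigma) auto
  also have "\<dots> = (\<Sum>(x, i)\<in>Sigma (Pow {1..n}) (\<lambda>x. {1..n} - x). f x * g (insert i x))"
    by (rule sum.reindex_bij_witness[where i = "\<lambda>(x, i). (insert i x, i)"
          and j = "\<lambda>(x, i). (x - {i}, i)"]) (auto simp: insert_absorb)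
  also have "\<dots> = (\<Sum>x\<in>Pow {1..n}. \<Sum>i\<in>{1..n} - x. f x * g (insert i x))"
    by (subst sum.Sigma) auto
  also have "\<dots> = ip n f (dn n g)"
    by (simp add: ip_def dn_def sum_distrib_left)
  finally show ?thesis .
qed

text \<open>Each lowering undoes one raising up to a factor; after a of them only a multiple of h is
  left, and a further one kills it.\<close>

lemma dn_up_funpow_eq_0:
  assumes "h \<in> harm n t" "a < b"
  shows "(dn n ^^ b) ((up n ^^ a) h) = 0"
  using assms(2)
proof (induction a arbitrary: b)
  case 0
  then obtain c where "b = Suc c"
    by (cases b) auto
  then show ?case
    using assms(1) by (simp add: funpow_swap1 harm_def flinear_zero[OF flinear_funpow[OF flinear_dn]])
next
  case (Suc a)
  then obtain c where c: "b = Suc c" "a < c"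
    by (cases b) auto
  have "(dn n ^^ b) ((up n ^^ Suc a) h) = (dn n ^^ c) (dn n ((up n ^^ Suc a) h))"
    by (simp only: c funpow_Suc_right comp_apply)
  also have "\<dots> = fscale (lamk n t (Suc (Suc a))) ((dn n ^^ c) ((up n ^^ a) h))"
    by (simp only: dn_up_funpow[OF assms(1)] flinear_fscale[OF flinear_funpow[OF flinear_dn]])
  also have "\<dots> = 0"
    by (simp only: Suc.IH[OF c(2)] fvs.scale_zero_right)
  finally show ?case .
qed

lemma ip_up_funpow: "ip n ((up n ^^ k) f) g = ip n f ((dn n ^^ k) g)"
  by (induction k arbitrary: g) (simp_all add: ip_up_left funpow_swap1[of "dn n"])

text \<open>For fixed layer i and degrees r < t the exponents are i-t < i-r, so this gives
  orthogonality of the pieces of different degree.\<close>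

lemma ip_up_funpow_harm:
  assumes "h \<in> harm n t" "a < b"
  shows "ip n ((up n ^^ a) h) ((up n ^^ b) g) = 0"
proof -
  have "ip n ((up n ^^ a) h) ((up n ^^ b) g) = ip n ((up n ^^ b) g) ((up n ^^ a) h)"
    by (rule ip_commute)
  also have "\<dots> = ip n 0 g"
    by (simp add: ip_up_funpow dn_up_funpow_eq_0[OF assms] ip_commute[of n g])
  finally show ?thesis
    by (simp add: ip_zero_left)
qed

text \<open>The value at x counts the chains that build x from z by adding one element at a time: k!
  orderings if z is contained in x, none otherwise. This is the bridge from the spanning functions
  of \<open>Usp\<close> to the raising operator.\<close>

lemma up_funpow_indicator:
  assumes "z \<subseteq> {1..n}"
  shows "(up n ^^ k) (indicator {z}) = fscale (fact k) (gfun n (card z + k) z)"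
proof (induction k)
  case 0
  have "x = z" if "x \<subseteq> {1..n}" "card x = card z" "z \<subseteq> x" for x
    using that by (metis card_subset_eq finite_atLeastAtMost finite_subset)
  then show ?case
    using assms by (auto simp: fun_eq_iff fun_apply gfun_def layer_def indicator_def)
next
  case (Suc k)
  show ?case
  proof
    fix x
    let ?i = "card z + k"
    have "(up n ^^ Suc k) (indicator {z}) = fscale (fact k) (up n (gfun n ?i z))"
      by (simp only: funpow.simps comp_apply Suc.IH up_simps)
    then have "(up n ^^ Suc k) (indicator {z}) x = fact k * up n (gfun n ?i z) x"
      by (simp only: fscale_apply)
    also have "\<dots> = fact (Suc k) * gfun n (Suc ?i) z x"
    proof (cases "x \<in> layer n (Suc ?i) \<and> z \<subseteq> x")
      case True
      then have x: "x \<subseteq> {1..n}" "card x = Suc ?i" "z \<subseteq> x" "finite x"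
        using finite_subset[of x "{1..n}"] by (auto simp: layer_def)
      have "up n (gfun n ?i z) x = (\<Sum>j\<in>x. if j \<in> x - z then 1 else 0)"
        using x by (simp add: up_def) (rule sum.cong, auto simp: gfun_def layer_def)
      also have "\<dots> = real (card (x - z))"
        using x(4) by (simp add: sum.If_cases Int_def set_diff_eq)
      also have "card (x - z) = Suc k"
        using x assms by (simp add: card_Diff_subset finite_subset)
      finally show ?thesis
        using True by (simp add: gfun_def)
    next
      case False
      have "gfun n ?i z (x - {j}) = 0" if "j \<in> x" "x \<subseteq> {1..n}" for j
        using False that card_Suc_Diff1[of x j] finite_subset[of x "{1..n}"]
        by (auto simp: gfun_def layer_def)
      then have "up n (gfun n ?i z) x = 0"
        by (simp add: up_def)
      then show ?thesis
        using False by (auto simp: gfun_def)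
    qed
    finally show "(up n ^^ Suc k) (indicator {z}) x = fscale (fact (Suc k)) (gfun n (card z + Suc k) z) x"
      by (simp add: fun_apply)
  qed
qed

lemma up_funpow_in_Usp:
  assumes "h \<in> funs_on (layer n t)" "t \<le> j" "t \<le> i"
  shows "(up n ^^ (i - t)) h \<in> Usp n i j"
proof -
  have "h = (\<Sum>z\<in>layer n t. fscale (h z) (indicator {z}))"
    using assms(1) by (intro funs_on_expand) auto
  then have "(up n ^^ (i - t)) h
      = (up n ^^ (i - t)) (\<Sum>z\<in>layer n t. fscale (h z) (indicator {z}))"
    by (rule arg_cong)
  also have "\<dots> = (\<Sum>z\<in>layer n t. fscale (h z * fact (i - t)) (gfun n i z))"
    unfolding up_funpow_simps
  proof (rule sum.cong)
    fix z assume "z \<in> layer n t"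
    then have "z \<subseteq> {1..n}" "card z + (i - t) = i"
      using assms by (auto simp: layer_def)
    then show "fscale (h z) ((up n ^^ (i - t)) (indicator {z}))
        = fscale (h z * fact (i - t)) (gfun n i z)"
      by (simp add: up_funpow_indicator)
  qed simp
  also have "\<dots> \<in> Usp n i j"
    unfolding Usp_def using assms
    by (intro fvs.span_sum fvs.span_scale fvs.span_base) (auto simp: layer_def)
  finally show ?thesis .
qed

text \<open>Up to a factorial, \<open>gfun n i z\<close> is a raised point mass on layer |z|. The
  harmonic decomposition of the point mass has degrees at most |z|, and raising does not change
  degrees.\<close>

lemma Usp_decomposition:
  assumes "2 * i \<le> n" "j \<le> i" "f \<in> Usp n i j"
  shows "\<exists>h. (\<forall>t. h t \<in> harm n t) \<and> f = (\<Sum>t\<le>j. (up n ^^ (i - t)) (h t))"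
proof -
  let ?R = "{\<Sum>t\<le>j. (up n ^^ (i - t)) (h t) | h. \<forall>t. h t \<in> harm n t}"
  have "fsubspace ?R"
  proof (rule fvs.subspaceI)
    have "0 = (\<Sum>t\<le>j. (up n ^^ (i - t)) 0)"
      by (simp add: up_funpow_simps)
    then show "0 \<in> ?R"
      using harm_simps(1) by (intro CollectI exI[of _ "\<lambda>_. 0"]) auto
  next
    fix x y assume "x \<in> ?R" "y \<in> ?R"
    then obtain h h' where "\<And>t. h t \<in> harm n t" "x = (\<Sum>t\<le>j. (up n ^^ (i - t)) (h t))"
      "\<And>t. h' t \<in> harm n t" "y = (\<Sum>t\<le>j. (up n ^^ (i - t)) (h' t))"
      by blast
    then show "x + y \<in> ?R"
      by (intro CollectI exI[of _ "\<lambda>t. h t + h' t"])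
        (auto simp: up_funpow_simps harm_simps sum.distrib)
  next
    fix c x assume "x \<in> ?R"
    then obtain h where "\<And>t. h t \<in> harm n t" "x = (\<Sum>t\<le>j. (up n ^^ (i - t)) (h t))"
      by blast
    then show "fscale c x \<in> ?R"
      by (intro CollectI exI[of _ "\<lambda>t. fscale c (h t)"])
        (auto simp: up_funpow_simps harm_simps fvs.scale_sum_right)
  qed
  moreover have "{gfun n i z | z. z \<subseteq> {1..n} \<and> card z \<le> j} \<subseteq> ?R"
  proof clarify
    fix z assume z: "z \<subseteq> {1..n}" "card z \<le> j"
    let ?k = "card z"
    have "indicator {z} \<in> funs_on (layer n ?k)"
      using z by (auto simp: funs_on_def layer_def indicator_def)
    then obtain h where h: "\<And>t. h t \<in> harm n t"
        "indicator {z} = (\<Sum>t\<le>?k. (up n ^^ (?k - t)) (h t))"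
      using layer_decomposition[of ?k n "indicator {z}"] assms z by auto
    let ?h = "\<lambda>t. if t \<le> ?k then fscale (1 / fact (i - ?k)) (h t) else 0"
    have "gfun n i z = fscale (1 / fact (i - ?k)) ((up n ^^ (i - ?k)) (indicator {z}))"
      using z assms by (simp add: up_funpow_indicator)
    also have "\<dots> = (\<Sum>t\<le>?k. (up n ^^ (i - ?k)) ((up n ^^ (?k - t)) (fscale (1 / fact (i - ?k)) (h t))))"
      unfolding h(2) by (simp add: up_funpow_simps fvs.scale_sum_right)
    also have "\<dots> = (\<Sum>t\<le>?k. (up n ^^ (i - t)) (?h t))"
    proof (rule sum.cong)
      fix t assume "t \<in> {..?k}"
      then have "i - t = (i - ?k) + (?k - t)" "t \<le> ?k"
        using z assms by auto
      then show "(up n ^^ (i - ?k)) ((up n ^^ (?k - t)) (fscale (1 / fact (i - ?k)) (h t)))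
          = (up n ^^ (i - t)) (?h t)"
        by (simp only: funpow_add comp_apply if_True)
    qed simp
    also have "\<dots> = (\<Sum>t\<le>j. (up n ^^ (i - t)) (?h t))"
      using z by (intro sum.mono_neutral_left) (auto simp: up_funpow_simps)
    finally have "gfun n i z = (\<Sum>t\<le>j. (up n ^^ (i - t)) (?h t))" .
    moreover have "?h t \<in> harm n t" for t
      using h harm_simps by simp
    ultimately show "\<exists>h. gfun n i z = (\<Sum>t\<le>j. (up n ^^ (i - t)) (h t)) \<and> (\<forall>t. h t \<in> harm n t)"
      by (intro exI[of _ ?h]) blast
  qed
  ultimately have "Usp n i j \<subseteq> ?R"
    unfolding Usp_def by (intro fvs.span_minimal)
  with assms(3) show ?thesis by blast
qed

text \<open>\<open>Usp n i t\<close> consists of the pieces of degree at most t, and pieces of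
  different degrees are orthogonal; the complement of \<open>Usp n i (t - 1)\<close> within it is
  the piece of degree t.\<close>

lemma Vsp_eq:
  assumes "t \<le> i" "2 * i \<le> n"
  shows "Vsp n i t = (up n ^^ (i - t)) ` harm n t"
proof (cases t)
  case 0
  show ?thesis
  proof (intro equalityI subsetI)
    fix f assume "f \<in> Vsp n i t"
    then have "f \<in> Usp n i 0"
      by (simp add: Vsp_def 0)
    then show "f \<in> (up n ^^ (i - t)) ` harm n t"
      using Usp_decomposition[of i n 0 f] assms 0 by auto
  next
    fix f assume "f \<in> (up n ^^ (i - t)) ` harm n t"
    then show "f \<in> Vsp n i t"
      using up_funpow_in_Usp[of _ n t 0 i] 0 by (auto simp: Vsp_def harm_def)
  qed
next
  case (Suc s)
  have layer: "(up n ^^ (i - r)) h \<in> funs_on (layer n i)" if "h \<in> harm n r" "r \<le> i" for h r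
    using up_funpow_funs_on[of h n r "i - r"] that by (simp add: harm_def)
  have orth: "ip n ((up n ^^ (i - t)) h) g = 0" if h: "h \<in> harm n t" and g: "g \<in> Usp n i s" for h g
  proof -
    obtain k where k: "\<And>r. k r \<in> harm n r" "g = (\<Sum>r\<le>s. (up n ^^ (i - r)) (k r))"
      using Usp_decomposition[of i n s g] g assms Suc by auto
    have "ip n ((up n ^^ (i - t)) h) ((up n ^^ (i - r)) (k r)) = 0" if "r \<le> s" for r
      using ip_up_funpow_harm[OF h, of "i - t" "i - r" "k r"] that Suc assms by simp
    then show ?thesis
      by (simp add: k(2) ip_sum_right)
  qed
  have V: "Vsp n i t = Usp n i t \<inter> perp_layer n i (Usp n i s)"
    by (simp add: Vsp_def Suc)
  show ?thesis
  proof (intro equalityI subsetI)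
    fix f assume "f \<in> (up n ^^ (i - t)) ` harm n t"
    then obtain h where h: "h \<in> harm n t" "f = (up n ^^ (i - t)) h"
      by blast
    then have "f \<in> Usp n i t"
      using up_funpow_in_Usp[of h n t t i] assms by (simp add: harm_def)
    moreover have "f \<in> perp_layer n i (Usp n i s)"
      using layer[OF h(1) assms(1)] orth[OF h(1)]
      by (simp add: perp_layer_def h(2) ip_layer)
    ultimately show "f \<in> Vsp n i t"
      by (simp add: V)
  next
    fix f assume "f \<in> Vsp n i t"
    then have f: "f \<in> Usp n i t" "f \<in> funs_on (layer n i)"
      "\<And>g. g \<in> Usp n i s \<Longrightarrow> (\<Sum>x\<in>layer n i. f x * g x) = 0"
      by (auto simp: V perp_layer_def)
    obtain h where h: "\<And>r. h r \<in> harm n r" "f = (\<Sum>r\<le>t. (up n ^^ (i - r)) (h r))"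
      using Usp_decomposition[of i n t f] f(1) assms by auto
    define g where "g = (\<Sum>r\<le>s. (up n ^^ (i - r)) (h r))"
    have feq: "f = g + (up n ^^ (i - t)) (h t)"
      by (simp add: h(2) Suc g_def)
    have g: "g \<in> Usp n i s"
      unfolding g_def Usp_def
    proof (rule fvs.span_sum, fold Usp_def)
      fix r assume "r \<in> {..s}"
      then show "(up n ^^ (i - r)) (h r) \<in> Usp n i s"
        using up_funpow_in_Usp[of "h r" n r s i] h(1)[of r] assms Suc by (simp add: harm_def)
    qed
    have glayer: "g \<in> funs_on (layer n i)"
      unfolding g_def using layer h(1) assms Suc by (intro fvs.subspace_sum[OF subspace_funs_on]) simp
    \<comment> \<open>The lower part g lies in \<open>Usp n i s\<close>, so it is orthogonal to f
      and to the part of degree t, hence to itself.\<close>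
    have "ip n f g = 0"
      using f(3)[OF g] ip_layer[OF f(2), of g] by simp
    then have "ip n g g = 0"
      using orth[OF h(1) g] by (simp add: feq ip_add_left)
    then have "g = 0"
      using ip_self_eq_0 glayer by blast
    then show "f \<in> (up n ^^ (i - t)) ` harm n t"
      using feq h(1) by simp
  qed
qed

section \<open>The eigenvalue equation on the band\<close>

text \<open>Eigenvector coordinates for the unsymmetrized matrix with entries 1 and
  \<open>b\<close>; hence the full product in the denominator, where the symmetric matrix has square
  roots.\<close>

definition jacobi_coeff :: "(nat \<Rightarrow> real) \<Rightarrow> real \<Rightarrow> nat \<Rightarrow> real" where
  "jacobi_coeff b lam k = poly (jacobi_poly b k) lam / (\<Prod>j<k. b j)"

lemma jacobi_coeff_0 [simp]: "jacobi_coeff b lam 0 = 1"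
  by (simp add: jacobi_coeff_def)

text \<open>The last summand is left as a quotient of p_(k+1) so that the identity also covers the
  final index, where \<open>b k\<close> may vanish and the summand is the end defect.\<close>

lemma jacobi_coeff_rec:
  assumes "\<And>j. j < k \<Longrightarrow> b j \<noteq> 0"
  shows "lam * jacobi_coeff b lam k = (if k = 0 then 0 else jacobi_coeff b lam (k - 1))
    + poly (jacobi_poly b (Suc k)) lam / (\<Prod>j<k. b j)"
proof (cases k)
  case (Suc l)
  have "b l \<noteq> 0"
    using assms Suc by simp
  then show ?thesis
    by (simp add: jacobi_coeff_def Suc add_divide_distrib diff_divide_distrib)
qed (simp add: jacobi_coeff_def)

lemma jacobi_coeff_Suc:
  assumes "\<And>j. j \<le> k \<Longrightarrow> b j \<noteq> 0"
  shows "poly (jacobi_poly b (Suc k)) lam / (\<Prod>j<k. b j) = b k * jacobi_coeff b lam (Suc k)"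
  using assms[of k] by (simp add: jacobi_coeff_def)

section \<open>Restriction to layers and the layerwise eigenvalue equation\<close>

lemma flinear_restr: "flinear (restr n i)"
  by (rule flinearI) (auto simp: restr_def fun_apply fun_eq_iff)

lemmas restr_simps = flinear_sum[OF flinear_restr] flinear_fscale[OF flinear_restr]
  flinear_add[OF flinear_restr] flinear_zero[OF flinear_restr]

lemma restr_layer:
  assumes "f \<in> funs_on (layer n j)"
  shows "restr n i f = (if i = j then f else 0)"
  using assms by (auto simp: restr_def funs_on_def layer_def fun_eq_iff fun_apply)

lemma restr_funs_on: "restr n i f \<in> funs_on (layer n i)"
  by (simp add: restr_def funs_on_def)

text \<open>The case distinction keeps truncated subtraction from making layer 0 its own
  predecessor.\<close>

definition restr_prev :: "nat \<Rightarrow> nat \<Rightarrow> (nat set \<Rightarrow> real) \<Rightarrow> (nat set \<Rightarrow> real)" where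
  "restr_prev n i f = (if i = 0 then 0 else restr n (i - 1) f)"

lemma up_layer_apply:
  assumes "x \<in> layer n i"
  shows "up n f x = up n (restr_prev n i f) x"
proof (cases i)
  case 0
  then have "x = {}"
    using assms finite_subset[of x "{1..n}"] by (auto simp: layer_def)
  then show ?thesis
    by (simp add: up_def)
next
  case (Suc j)
  have x: "x \<subseteq> {1..n}" "card x = Suc j" "finite x"
    using assms Suc finite_subset[of x "{1..n}"] by (auto simp: layer_def)
  have "f (x - {a}) = restr_prev n i f (x - {a})" if "a \<in> x" for a
    using x that by (auto simp: restr_prev_def restr_def layer_def Suc)
  then show ?thesis
    by (simp add: up_def)
qed

lemma dn_layer_apply:
  assumes "x \<in> layer n i"
  shows "dn n f x = dn n (restr n (Suc i) f) x"
proof -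
  have x: "x \<subseteq> {1..n}" "card x = i" "finite x"
    using assms finite_subset[of x "{1..n}"] by (auto simp: layer_def)
  have "f (insert a x) = restr n (Suc i) f (insert a x)" if "a \<in> {1..n} - x" for a
    using x that by (auto simp: restr_def layer_def)
  then show ?thesis
    by (simp add: dn_def)
qed

lemma sum_neighbours:
  assumes x: "x \<subseteq> {1..n}"
  shows "(\<Sum>y\<in>{y. y \<subseteq> {1..n} \<and> hadj x y}. f y) = up n f x + dn n f x"
proof -
  let ?D = "(\<lambda>i. x - {i}) ` x" and ?U = "(\<lambda>i. insert i x) ` ({1..n} - x)"
  have fin: "finite x"
    using x by (rule finite_subset) simp
  have "{y. y \<subseteq> {1..n} \<and> hadj x y} = ?D \<union> ?U"
  proof (intro equalityI subsetI)
    fix y assume y: "y \<in> {y. y \<subseteq> {1..n} \<and> hadj x y}"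
    then obtain i where i: "(x - y) \<union> (y - x) = {i}"
      unfolding hadj_def One_nat_def card_1_singleton_iff by blast
    have mem: "j \<in> (x - y) \<union> (y - x) \<longleftrightarrow> j = i" for j
      unfolding i by simp
    show "y \<in> ?D \<union> ?U"
    proof (cases "i \<in> x")
      case True
      have "j \<in> y \<longleftrightarrow> j \<in> x - {i}" for j
        using mem[of j] True by auto
      then have "y = x - {i}" by (rule Set.set_eqI)
      then show ?thesis using True by simp
    next
      case False
      have "j \<in> y \<longleftrightarrow> j \<in> insert i x" for j
        using mem[of j] False by auto
      then have "y = insert i x" by (rule Set.set_eqI)
      then show ?thesis using False y by simp
    qed
  next
    fix y assume "y \<in> ?D \<union> ?U"
    then consider i where "i \<in> x" "y = x - {i}" | i where "i \<in> {1..n} - x" "y = insert i x"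
      by auto
    then show "y \<in> {y. y \<subseteq> {1..n} \<and> hadj x y}"
    proof cases
      case (1 i)
      then have "(x - y) \<union> (y - x) = {i}" by auto
      then have "hadj x y" by (simp add: hadj_def)
      moreover have "y \<subseteq> {1..n}" using 1 x by auto
      ultimately show ?thesis by simp
    next
      case (2 i)
      then have "(x - y) \<union> (y - x) = {i}" by auto
      then have "hadj x y" by (simp add: hadj_def)
      moreover have "y \<subseteq> {1..n}" using 2 x by auto
      ultimately show ?thesis by simp
    qed
  qed
  moreover have "?D \<inter> ?U = {}"
    by auto
  moreover have "inj_on (\<lambda>i. x - {i}) x" "inj_on (\<lambda>i. insert i x) ({1..n} - x)"
    by (auto intro!: inj_onI)
  moreover have "finite ?D" "finite ?U"
    using fin by simp_all
  ultimately show ?thesis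
    using x by (simp only: sum.union_disjoint sum.reindex up_def dn_def comp_def if_True)
qed

text \<open>The support of f does the truncation: neighbours outside the band contribute 0, so the
  operators of the full cube may be used.\<close>

lemma adjop_apply:
  assumes "f \<in> funs_on (band n r1 r2)" "x \<in> band n r1 r2"
  shows "adjop n r1 r2 f x = up n f x + dn n f x"
proof -
  have "(\<Sum>y\<in>{y \<in> band n r1 r2. hadj x y}. f y) = (\<Sum>y\<in>{y. y \<subseteq> {1..n} \<and> hadj x y}. f y)"
    using assms(1) by (intro sum.mono_neutral_left) (auto simp: band_def funs_on_def)
  then show ?thesis
    using assms sum_neighbours[of x n f] by (simp add: adjop_def band_def)
qed

lemma funs_on_eq_iff:
  assumes "f \<in> funs_on X" "g \<in> funs_on X"
  shows "(\<forall>x\<in>X. f x = g x) \<longleftrightarrow> f = g"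
proof
  assume eq: "\<forall>x\<in>X. f x = g x"
  show "f = g"
  proof
    fix x show "f x = g x"
      using assms eq by (cases "x \<in> X") (auto simp: funs_on_def)
  qed
qed simp

text \<open>Splitting by layers makes the equation accessible to the harmonic decomposition. At the
  ends of the band the terms from outside layers are 0 by the support of f.\<close>

lemma eigsp_iff:
  "f \<in> eigsp n r1 r2 lam \<longleftrightarrow> f \<in> funs_on (band n r1 r2) \<and>
    (\<forall>i\<in>{r1..r2}. up n (restr_prev n i f) + dn n (restr n (Suc i) f) = fscale lam (restr n i f))"
proof (cases "f \<in> funs_on (band n r1 r2)")
  case f: True
  let ?L = "\<lambda>i. up n (restr_prev n i f) + dn n (restr n (Suc i) f)"
  have L: "?L i \<in> funs_on (layer n i)" for i
  proof -
    have "up n (restr_prev n i f) \<in> funs_on (layer n i)"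
      using up_funs_on[OF restr_funs_on] fvs.subspace_0[OF subspace_funs_on]
      by (cases i) (auto simp: restr_prev_def up_simps)
    then show ?thesis
      using fvs.subspace_add[OF subspace_funs_on] dn_funs_on[OF restr_funs_on] by blast
  qed
  have pt: "adjop n r1 r2 f x = ?L i x" "fscale lam f x = fscale lam (restr n i f) x"
    if "x \<in> layer n i" "i \<in> {r1..r2}" for x i
  proof -
    have "x \<in> band n r1 r2"
      using that by (auto simp: layer_def band_def)
    then show "adjop n r1 r2 f x = ?L i x"
      using adjop_apply[OF f] up_layer_apply[OF that(1), of f] dn_layer_apply[OF that(1), of f]
      by (simp add: fun_apply)
    show "fscale lam f x = fscale lam (restr n i f) x"
      using that by (simp add: fun_apply restr_def)
  qed
  have "adjop n r1 r2 f = fscale lam f \<longleftrightarrow>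
      (\<forall>x\<in>band n r1 r2. adjop n r1 r2 f x = fscale lam f x)"
    using f by (auto simp: fun_eq_iff adjop_def funs_on_def fun_apply)
  also have "\<dots> \<longleftrightarrow> (\<forall>i\<in>{r1..r2}. \<forall>x\<in>layer n i. adjop n r1 r2 f x = fscale lam f x)"
    by (auto simp: band_def layer_def)
  also have "\<dots> \<longleftrightarrow> (\<forall>i\<in>{r1..r2}. \<forall>x\<in>layer n i. ?L i x = fscale lam (restr n i f) x)"
    using pt by simp
  also have "\<dots> \<longleftrightarrow> (\<forall>i\<in>{r1..r2}. ?L i = fscale lam (restr n i f))"
  proof (intro ball_cong refl)
    fix i
    have "fscale lam (restr n i f) \<in> funs_on (layer n i)"
      using fvs.subspace_scale[OF subspace_funs_on restr_funs_on] .
    with L[of i] show "(\<forall>x\<in>layer n i. ?L i x = fscale lam (restr n i f) x) \<longleftrightarrow>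
        ?L i = fscale lam (restr n i f)"
      by (rule funs_on_eq_iff)
  qed
  finally show ?thesis
    using f by (simp add: eigsp_def)
qed (simp add: eigsp_def)

lemma subspace_eigsp: "fsubspace (eigsp n r1 r2 lam)"
proof -
  have "flinear (adjop n r1 r2)"
    by (rule flinearI) (auto simp: adjop_def fun_eq_iff fun_apply sum.distrib sum_distrib_left)
  then show ?thesis
    using subspace_funs_on[of "band n r1 r2"]
    by (auto simp: fvs.subspace_def eigsp_def flinear_add flinear_fscale flinear_zero
      fvs.scale_right_distrib mult.commute)
qed

lemma finite_band [simp]: "finite (band n r1 r2)"
  by (rule finite_subset[of _ "Pow {1..n}"]) (auto simp: band_def)

lemma layer_subset_band: "i \<in> {r1..r2} \<Longrightarrow> funs_on (layer n i) \<subseteq> funs_on (band n r1 r2)"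
  by (auto simp: funs_on_def layer_def band_def)

lemma restr_outside_band:
  assumes "f \<in> funs_on (band n r1 r2)" "i \<notin> {r1..r2}"
  shows "restr n i f = 0"
  using assms by (auto simp: restr_def funs_on_def layer_def band_def fun_eq_iff fun_apply)

lemma eq_if_restr_eq:
  assumes "f \<in> funs_on (band n r1 r2)" "g \<in> funs_on (band n r1 r2)"
    and "\<And>i. restr n i f = restr n i g"
  shows "f = g"
proof
  fix x
  show "f x = g x"
  proof (cases "x \<subseteq> {1..n}")
    case True
    then show ?thesis
      using fun_cong[OF assms(3)[of "card x"], of x] by (simp add: restr_def layer_def)
  next
    case False
    then show ?thesis
      using assms(1,2) by (auto simp: funs_on_def band_def)
  qed
qed

section \<open>The eigenspaces for each degree\<close>

locale hypercube_band =
  fixes n r1 r2 :: nat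
  assumes r1_less_r2: "r1 < r2" and r2_le_half: "2 * r2 \<le> n"
begin

text \<open>The factor picked up when a raised harmonic function of degree t is lowered from layer
  \<open>max t r1 + i + 1\<close> to layer \<open>max t r1 + i\<close>.\<close>

definition offdiag :: "nat \<Rightarrow> nat \<Rightarrow> real" where
  "offdiag t i = lamk n t (max t r1 - t + 2 + i)"

definition msize :: "nat \<Rightarrow> nat" where
  "msize t = r2 - max t r1 + 1"

definition roots :: "nat \<Rightarrow> real set" where
  "roots t = {lam. poly (jacobi_poly (offdiag t) (msize t)) lam = 0}"

text \<open>The default 0 encodes the boundary conditions, so that one recurrence can be stated for
  all layers of the band from t on.\<close>

definition coef :: "nat \<Rightarrow> real \<Rightarrow> nat \<Rightarrow> real" where
  "coef t lam i = (if max t r1 \<le> i \<and> i \<le> r2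
     then jacobi_coeff (offdiag t) lam (i - max t r1) else 0)"

text \<open>The image of \<open>harm n t\<close> under this map serves as the space W_t for the
  eigenvalue \<open>lam\<close>.\<close>

definition lift :: "nat \<Rightarrow> real \<Rightarrow> (nat set \<Rightarrow> real) \<Rightarrow> (nat set \<Rightarrow> real)" where
  "lift t lam h = (\<Sum>i\<in>{max t r1..r2}. fscale (coef t lam i) ((up n ^^ (i - t)) h))"

lemma offdiag_pos:
  assumes "t \<le> r2" "Suc i < msize t"
  shows "offdiag t i > 0"
  using assms r2_le_half lamk_pos[of t "max t r1 - t + 1 + i" r2 n]
  by (simp add: offdiag_def msize_def)

lemma Mt_eq: "Mt n r1 r2 t = jacobi_mat (offdiag t) (msize t)"
  unfolding Mt_def jacobi_mat_def offdiag_def msize_def Let_def by (rule refl)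

lemma eigenvalue_Mt_iff:
  assumes "t \<le> r2"
  shows "eigenvalue (Mt n r1 r2 t) lam \<longleftrightarrow> lam \<in> roots t"
proof -
  have "msize t > 0"
    by (simp add: msize_def)
  then show ?thesis
    unfolding Mt_eq roots_def mem_Collect_eq using offdiag_pos[OF assms]
    by (rule eigenvalue_jacobi_mat_iff)
qed

lemma card_roots:
  assumes "t \<le> r2"
  shows "card (roots t) = msize t"
  unfolding roots_def using offdiag_pos[OF assms] by (rule card_roots_jacobi_poly)

text \<open>Stated for arbitrary \<open>lam\<close>: the defect at i = r2 vanishes exactly at the
  roots. Vanishing gives eigenvectors, non-vanishing excludes a component of degree t.\<close>

lemma coef_rec:
  assumes "t \<le> r2" "t \<le> i" "i \<in> {r1..r2}"
  shows "(if i = 0 then 0 else coef t lam (i - 1)) + lamk n t (Suc (Suc (i - t))) * coef t lam (Suc i)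
    = lam * coef t lam i -
      (if i = r2 then poly (jacobi_poly (offdiag t) (msize t)) lam / (\<Prod>j<msize t - 1. offdiag t j)
       else 0)"
proof -
  define ts where "ts = max t r1"
  define k where "k = i - ts"
  have ik: "i = ts + k" "ts + k \<le> r2" "msize t = r2 - ts + 1" "t \<le> ts"
    using assms by (auto simp: k_def ts_def msize_def)
  have coef: "coef t lam j = (if ts \<le> j \<and> j \<le> r2 then jacobi_coeff (offdiag t) lam (j - ts) else 0)" for j
    by (simp only: coef_def ts_def)
  have nz: "offdiag t j \<noteq> 0" if "Suc j < msize t" for j
    using offdiag_pos[OF assms(1) that] by simp
  have 1: "lam * jacobi_coeff (offdiag t) lam k
      = (if k = 0 then 0 else jacobi_coeff (offdiag t) lam (k - 1))
        + poly (jacobi_poly (offdiag t) (Suc k)) lam / (\<Prod>j<k. offdiag t j)"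
    using ik nz by (intro jacobi_coeff_rec) simp
  have 2: "coef t lam i = jacobi_coeff (offdiag t) lam k"
    using ik(2) by (simp add: coef ik(1))
  have 3: "(if i = 0 then 0 else coef t lam (i - 1))
      = (if k = 0 then 0 else jacobi_coeff (offdiag t) lam (k - 1))"
    using ik(2) by (cases k) (auto simp: coef ik(1))
  show ?thesis
  proof (cases "i = r2")
    case True
    then have "msize t = Suc k" "coef t lam (Suc i) = 0"
      using ik by (auto simp: coef)
    then show ?thesis
      unfolding 2 3 1 by (simp only: True) simp
  next
    case False
    then have k: "Suc k < msize t" "Suc i \<le> r2"
      using ik by auto
    have 4: "poly (jacobi_poly (offdiag t) (Suc k)) lam / (\<Prod>j<k. offdiag t j)
        = offdiag t k * jacobi_coeff (offdiag t) lam (Suc k)"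
      using k nz by (intro jacobi_coeff_Suc) simp
    have 5: "coef t lam (Suc i) = jacobi_coeff (offdiag t) lam (Suc k)"
      using k ik by (simp add: coef)
    have "Suc (Suc (i - t)) = ts - t + 2 + k"
      using ik by simp
    then have 6: "lamk n t (Suc (Suc (i - t))) = offdiag t k"
      by (simp only: offdiag_def ts_def)
    show ?thesis
      unfolding 2 3 1 4 5 6 by (simp only: False if_False diff_0_right)
  qed
qed

lemma coef_rec_roots:
  assumes "t \<le> r2" "t \<le> i" "i \<in> {r1..r2}" "lam \<in> roots t"
  shows "(if i = 0 then 0 else coef t lam (i - 1)) + lamk n t (Suc (Suc (i - t))) * coef t lam (Suc i)
    = lam * coef t lam i"
  using coef_rec[OF assms(1-3), of lam] assms(4) by (simp add: roots_def)

lemma coef_start: "t \<le> r2 \<Longrightarrow> coef t lam (max t r1) = 1"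
  using r1_less_r2 by (simp add: coef_def)

lemma flinear_lift: "flinear (lift t lam)"
  by (rule flinearI) (simp_all add: lift_def up_funpow_simps fvs.scale_right_distrib sum.distrib
    fvs.scale_sum_right mult.commute)

lemma up_funpow_harm_layer:
  assumes "h \<in> harm n t" "t \<le> i"
  shows "(up n ^^ (i - t)) h \<in> funs_on (layer n i)"
  using up_funpow_funs_on[of h n t "i - t"] assms by (simp add: harm_def)

lemma lift_funs_on:
  assumes "h \<in> harm n t"
  shows "lift t lam h \<in> funs_on (band n r1 r2)"
  unfolding lift_def
proof (intro fvs.subspace_sum[OF subspace_funs_on] fvs.subspace_scale[OF subspace_funs_on])
  fix i assume i: "i \<in> {max t r1..r2}"
  then show "(up n ^^ (i - t)) h \<in> funs_on (band n r1 r2)"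
    using up_funpow_harm_layer[OF assms, of i] layer_subset_band[of i r1 r2 n] by auto
qed

lemma restr_lift:
  assumes "h \<in> harm n t"
  shows "restr n i (lift t lam h) = fscale (coef t lam i) ((up n ^^ (i - t)) h)"
proof -
  have "restr n i (lift t lam h) = (\<Sum>j\<in>{max t r1..r2}.
      if i = j then fscale (coef t lam i) ((up n ^^ (i - t)) h) else 0)"
    unfolding lift_def restr_simps
  proof (rule sum.cong)
    fix j assume "j \<in> {max t r1..r2}"
    then show "fscale (coef t lam j) (restr n i ((up n ^^ (j - t)) h))
        = (if i = j then fscale (coef t lam i) ((up n ^^ (i - t)) h) else 0)"
      using up_funpow_harm_layer[OF assms, of j] by (simp add: restr_layer)
  qed simp
  also have "\<dots> = fscale (coef t lam i) ((up n ^^ (i - t)) h)"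
    by (auto simp: coef_def)
  finally show ?thesis .
qed

lemma dn_up_funpow_diff:
  assumes "h \<in> harm n t" "t \<le> i"
  shows "dn n ((up n ^^ (Suc i - t)) h) = fscale (lamk n t (Suc (Suc (i - t)))) ((up n ^^ (i - t)) h)"
  using dn_up_funpow[OF assms(1), of "i - t"] assms(2) by (simp add: Suc_diff_le)

lemma lift_in_eigsp:
  assumes h: "h \<in> harm n t" and t: "t \<le> r2" and lam: "lam \<in> roots t"
  shows "lift t lam h \<in> eigsp n r1 r2 lam"
  unfolding eigsp_iff
proof (intro conjI ballI lift_funs_on[OF h])
  fix i assume i: "i \<in> {r1..r2}"
  let ?f = "lift t lam h"
  show "up n (restr_prev n i ?f) + dn n (restr n (Suc i) ?f) = fscale lam (restr n i ?f)"
  proof (cases "t \<le> i")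
    case True
    have "up n (restr_prev n i ?f)
        = fscale (if i = 0 then 0 else coef t lam (i - 1)) ((up n ^^ (i - t)) h)"
    \<comment> \<open>Here the exponent \<open>i - 1 - t\<close> is truncated, but either there is
      no previous layer or its coefficient is 0.\<close>
    proof (cases "i = 0 \<or> t = i")
      case True
      then have "i = 0 \<or> coef t lam (i - 1) = 0"
        by (auto simp: coef_def)
      then show ?thesis
        using h by (auto simp: restr_prev_def restr_lift up_simps)
    next
      case False
      then have "i - t = Suc (i - 1 - t)"
        using \<open>t \<le> i\<close> by arith
      then show ?thesis
        using h False by (simp add: restr_prev_def restr_lift up_simps)
    qed
    moreover have "dn n (restr n (Suc i) ?f)
        = fscale (lamk n t (Suc (Suc (i - t))) * coef t lam (Suc i)) ((up n ^^ (i - t)) h)"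
      using h True by (simp add: restr_lift dn_simps dn_up_funpow_diff mult.commute del: funpow.simps)
    ultimately show ?thesis
      using coef_rec_roots[OF t True i lam] h
      by (simp add: restr_lift flip: fvs.scale_left_distrib)
  next
    case False
    then have "coef t lam i = 0" "i \<noteq> 0 \<Longrightarrow> coef t lam (i - 1) = 0"
      by (auto simp: coef_def)
    \<comment> \<open>For i < t the exponent \<open>Suc i - t\<close> is 0, so \<open>dn\<close>
      meets a multiple of h itself and kills it.\<close>
    moreover have "dn n (restr n (Suc i) ?f) = 0"
      using False h by (simp add: restr_lift dn_simps harm_def)
    ultimately show ?thesis
      using h by (auto simp: restr_prev_def restr_lift up_simps)
  qed
qed

text \<open>The first coefficient is 1, so on the lowest layer of the support the lifted function is
  just the raised h. Injectivity of the composition serves both \<open>lift\<close> and the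
  restriction on its image.\<close>

lemma inj_on_restr_lift:
  assumes "t \<le> r2"
  shows "inj_on (\<lambda>h. restr n (max t r1) (lift t lam h)) (harm n t)"
proof -
  have "inj_on (up n ^^ (max t r1 - t)) (harm n t)"
    using assms r1_less_r2 r2_le_half
    by (intro inj_on_up_funpow_harm[of t _ r2]) auto
  then show ?thesis
    using assms by (simp add: restr_lift coef_start cong: inj_on_cong)
qed

lemma inj_on_lift:
  assumes "t \<le> r2"
  shows "inj_on (lift t lam) (harm n t)"
  using inj_on_restr_lift[OF assms, of lam] by (simp add: inj_on_def)

lemma subspace_lift_image: "fsubspace (lift t lam ` harm n t)"
proof -
  interpret lift: Vector_Spaces.linear fscale fscale "lift t lam" by (rule flinear_lift)
  show ?thesis by (rule lift.subspace_image[OF subspace_harm])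
qed

lemma fdim_lift_image:
  assumes "t \<le> r2"
  shows "int (fdim (lift t lam ` harm n t)) = multt n t"
  using fvp.dim_image_inj_on[OF flinear_lift subspace_harm inj_on_lift[OF assms]]
    fdim_harm[of t n] assms r2_le_half by simp

lemma restr_lift_in_Vsp:
  assumes "h \<in> harm n t" "t \<le> i" "i \<le> r2"
  shows "restr n i (lift t lam h) \<in> Vsp n i t"
  using Vsp_eq[of t i n] assms r2_le_half
  by (simp add: restr_lift flinear_fscale[OF flinear_up_funpow, symmetric] harm_simps)

lemma fspan_restr_lift:
  assumes "t \<le> r2"
  shows "fspan (restr n (max t r1) ` lift t lam ` harm n t) = Vsp n (max t r1) t"
proof -
  interpret up: Vector_Spaces.linear fscale fscale "up n ^^ (max t r1 - t)"
    by (rule flinear_up_funpow)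
  have "restr n (max t r1) ` lift t lam ` harm n t = (up n ^^ (max t r1 - t)) ` harm n t"
    using assms by (simp add: image_image restr_lift coef_start cong: image_cong_simp)
  moreover have "fspan \<dots> = \<dots>"
    using up.subspace_image[OF subspace_harm] by (simp add: fvs.span_eq_iff)
  ultimately show ?thesis
    using Vsp_eq[of t "max t r1" n] assms r1_less_r2 r2_le_half by simp
qed

lemma lift_vanishes:
  assumes "h \<in> harm n t" "x \<in> band n r1 r2" "card x < max t r1"
  shows "lift t lam h x = 0"
proof -
  have "x \<in> layer n (card x)"
    using assms(2) by (simp add: layer_def band_def)
  then have "lift t lam h x = restr n (card x) (lift t lam h) x"
    by (simp add: restr_def)
  moreover have "coef t lam (card x) = 0"
    using assms(3) by (auto simp: coef_def)
  ultimately show ?thesis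
    using assms(1) by (simp add: restr_lift fun_apply)
qed

section \<open>Independence over the degrees, completeness and multiplicities\<close>

lemma lift_independent:
  assumes "\<And>t. t \<in> T \<Longrightarrow> t \<le> r2" "\<And>t. t \<in> T \<Longrightarrow> h t \<in> harm n t"
    and sum: "(\<Sum>t\<in>T. lift t lam (h t)) = 0" and s: "s \<in> T"
  shows "h s = 0"
proof -
  \<comment> \<open>In this layer degree s has coefficient 1, while every degree t > i has
    coefficient 0, so the relation becomes one among harmonic components of the layer.\<close>
  define i where "i = max s r1"
  have i: "i \<le> r2" "s \<le> i"
    using assms(1)[OF s] r1_less_r2 by (auto simp: i_def)
  have fin: "finite T"
    using assms(1) finite_subset[of T "{..r2}"] by auto
  let ?h = "\<lambda>t. if t \<in> T then fscale (coef t lam i) (h t) else 0"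
  have "(\<Sum>t\<le>i. (up n ^^ (i - t)) (?h t)) = (\<Sum>t\<in>T. (up n ^^ (i - t)) (fscale (coef t lam i) (h t)))"
    using fin by (intro sum.mono_neutral_cong) (auto simp: coef_def flinear_zero[OF flinear_up_funpow])
  also have "\<dots> = (\<Sum>t\<in>T. restr n i (lift t lam (h t)))"
    using assms(2) by (intro sum.cong) (auto simp: restr_lift up_funpow_simps)
  also have "\<dots> = restr n i (\<Sum>t\<in>T. lift t lam (h t))"
    by (simp add: restr_simps)
  also have "\<dots> = 0"
    by (simp add: sum restr_simps)
  finally have eq: "(\<Sum>t\<le>i. (up n ^^ (i - t)) (?h t)) = 0" .
  have "?h s = 0"
    by (rule layer_decomposition_unique[of i n ?h s])
      (use i r2_le_half eq assms(2) in \<open>auto simp: harm_simps\<close>)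
  then show ?thesis
    using s coef_start[OF assms(1)[OF s]] by (simp add: i_def)
qed

text \<open>Comparing harmonic components layer by layer turns the eigenvalue equation into the
  three-term recurrence, separately for each degree.\<close>

lemma eigsp_decomposition:
  assumes f: "f \<in> eigsp n r1 r2 lam"
  shows "\<exists>h. (\<forall>t. h t \<in> harm n t) \<and> f = (\<Sum>t | t \<le> r2 \<and> lam \<in> roots t. lift t lam (h t))"
proof -
  have fband: "f \<in> funs_on (band n r1 r2)"
    using f by (simp add: eigsp_def)
  have "\<forall>i\<in>{..r2}. \<exists>h. (\<forall>t. h t \<in> harm n t) \<and> restr n i f = (\<Sum>t\<le>i. (up n ^^ (i - t)) (h t))"
  proof
    fix i assume "i \<in> {..r2}"
    then have "2 * i \<le> n"
      using r2_le_half by simp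
    then show "\<exists>h. (\<forall>t. h t \<in> harm n t) \<and> restr n i f = (\<Sum>t\<le>i. (up n ^^ (i - t)) (h t))"
      by (rule layer_decomposition[OF _ restr_funs_on])
  qed
  from bchoice[OF this] obtain H where H: "\<And>i t. i \<le> r2 \<Longrightarrow> H i t \<in> harm n t"
      "\<And>i. i \<le> r2 \<Longrightarrow> restr n i f = (\<Sum>t\<le>i. (up n ^^ (i - t)) (H i t))"
    by auto
  \<comment> \<open>Zero outside the band and for degrees above the layer, so that sums can be
    extended and the recurrence includes both ends.\<close>
  define g where "g i t = (if i \<in> {r1..r2} \<and> t \<le> i then H i t else 0)" for i t
  have g: "g i t \<in> harm n t" for i t
    using H(1) by (simp add: g_def harm_simps)
  have restr_f: "restr n i f = (\<Sum>t\<le>i. (up n ^^ (i - t)) (g i t))" for i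
    using H(2)[of i] restr_outside_band[OF fband, of i]
    by (cases "i \<in> {r1..r2}") (auto simp: g_def flinear_zero[OF flinear_up_funpow])
  define gp where "gp i t = (if i = 0 then 0 else g (i - 1) t)" for i t
  have rec: "gp i t + fscale (lamk n t (Suc (Suc (i - t)))) (g (Suc i) t) = fscale lam (g i t)"
    if i: "i \<in> {r1..r2}" and t: "t \<le> i" for i t
  proof -
    have 1: "up n (restr_prev n i f) = (\<Sum>t\<le>i. (up n ^^ (i - t)) (gp i t))"
    proof (cases i)
      case (Suc j)
      have "g j (Suc j) = 0"
        by (simp add: g_def)
      then show ?thesis
        by (simp add: Suc restr_prev_def restr_f up_simps gp_def Suc_diff_le)
    qed (simp add: restr_prev_def up_simps gp_def)
    \<comment> \<open>The component of top degree in layer i+1 is harmonic there; lowering drops it,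
      and both sums run up to i.\<close>
    have "dn n (g (Suc i) (Suc i)) = 0"
      using g[of "Suc i" "Suc i"] by (simp add: harm_def)
    then have "dn n (restr n (Suc i) f) = (\<Sum>t\<le>i. dn n ((up n ^^ (Suc i - t)) (g (Suc i) t)))"
      by (simp add: restr_f dn_simps)
    also have "\<dots> = (\<Sum>t\<le>i. (up n ^^ (i - t)) (fscale (lamk n t (Suc (Suc (i - t)))) (g (Suc i) t)))"
      using g by (intro sum.cong) (auto simp: dn_up_funpow_diff up_funpow_simps simp del: funpow.simps)
    finally have 2: "dn n (restr n (Suc i) f) = \<dots>" .
    let ?d = "\<lambda>t. gp i t + fscale (lamk n t (Suc (Suc (i - t)))) (g (Suc i) t) - fscale lam (g i t)"
    have "(\<Sum>t\<le>i. (up n ^^ (i - t)) (?d t))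
        = up n (restr_prev n i f) + dn n (restr n (Suc i) f) - fscale lam (restr n i f)"
      unfolding 1 2 unfolding restr_f
      by (simp add: up_funpow_simps sum.distrib sum_subtractf fvs.scale_sum_right)
    also have "\<dots> = 0"
      using f i by (simp add: eigsp_iff)
    finally have eq: "(\<Sum>t\<le>i. (up n ^^ (i - t)) (?d t)) = 0" .
    have "gp i t \<in> harm n t" for t
      using g by (simp add: gp_def harm_simps)
    then have "?d t \<in> harm n t" for t
      using g by (intro harm_simps)
    then have "?d t = 0"
      using layer_decomposition_unique[of i n ?d t] i t eq r2_le_half by simp
    then show ?thesis by simp
  qed
  \<comment> \<open>Since \<open>lamk\<close> is positive, the recurrence can be solved for the next
    layer; the lowest component determines all others, with the same coefficients as in
    \<open>lift\<close>.\<close>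
  have g_coef: "g i t = fscale (coef t lam i) (g (max t r1) t)" if t: "t \<le> r2" for i t
  proof (cases "max t r1 \<le> i \<and> i \<le> r2")
    case False
    then show ?thesis by (auto simp: g_def coef_def)
  next
    case True
    then show ?thesis
    proof (induction i rule: less_induct)
      case (less i)
      show ?case
      proof (cases "i = max t r1")
        case True
        then show ?thesis using coef_start[OF t] by simp
      next
        case False
        then have "max t r1 < i"
          using less.prems by linarith
        then obtain j where "i = Suc j"
          by (cases i) auto
        with \<open>max t r1 < i\<close> have j: "i = Suc j" "max t r1 \<le> j" "j < r2"
          using less.prems by linarith+
        define c where "c = lamk n t (Suc (Suc (j - t)))"
        define g0 where "g0 = g (max t r1) t"
        have jt: "j \<in> {r1..r2}" "t \<le> j"
          using j by auto
        have c: "c > 0"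
          using lamk_pos[of t "Suc (j - t)" r2 n] j r2_le_half by (simp add: c_def)
        have gj: "g j t = fscale (coef t lam j) g0"
          using less.IH[of j] j by (simp add: g0_def)
        have gpj: "gp j t = fscale (if j = 0 then 0 else coef t lam (j - 1)) g0"
        proof (cases "j = 0 \<or> j = max t r1")
          case True
          then have "j = 0 \<or> g (j - 1) t = 0 \<and> coef t lam (j - 1) = 0"
            by (auto simp: g_def coef_def max_def split: if_splits)
          then show ?thesis by (auto simp: gp_def)
        next
          case False
          then have "j \<noteq> 0" "j - 1 < i" "max t r1 \<le> j - 1 \<and> j - 1 \<le> r2"
            using j by linarith+
          then show ?thesis
            using less.IH[of "j - 1"] by (simp only: gp_def g0_def if_False)
        qed
        have "fscale c (g i t) = fscale lam (g j t) - gp j t"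
          using rec[OF jt] j by (simp add: c_def algebra_simps)
        also have "\<dots> = fscale (lam * coef t lam j - (if j = 0 then 0 else coef t lam (j - 1))) g0"
          by (simp only: gj gpj fvs.scale_scale fvs.scale_left_diff_distrib)
        also have "lam * coef t lam j - (if j = 0 then 0 else coef t lam (j - 1)) = c * coef t lam i"
          using coef_rec[OF t jt(2,1), of lam] j by (simp add: c_def)
        finally have "fscale c (g i t) = fscale c (fscale (coef t lam i) g0)"
          by simp
        then show ?thesis
          using c fvs.scale_cancel_left g0_def by (metis less_irrefl)
      qed
    qed
  qed
  \<comment> \<open>In layer r2 nothing comes from above. The eigenvalue equation and
    \<open>coef_rec\<close> give two values for \<open>gp r2 t\<close>, differing by
    \<open>?P\<close> times the lowest component, and \<open>?P\<close> is non-zero off the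
    roots.\<close>
  have zero: "g (max t r1) t = 0" if t: "t \<le> r2" and nr: "lam \<notin> roots t" for t
  proof -
    let ?P = "poly (jacobi_poly (offdiag t) (msize t)) lam / (\<Prod>j<msize t - 1. offdiag t j)"
    have r2: "r2 \<in> {r1..r2}"
      using r1_less_r2 by simp
    have "offdiag t j \<noteq> 0" if "j < msize t - 1" for j
      using offdiag_pos[OF t, of j] that by fastforce
    then have "?P \<noteq> 0"
      using nr by (simp add: roots_def)
    have "g (Suc r2) t = 0" "coef t lam (Suc r2) = 0"
      by (auto simp: g_def coef_def)
    note ends = this
    have "gp r2 t = fscale lam (g r2 t)"
      using rec[OF r2 t] by (simp only: ends fvs.scale_zero_right add_0_right)
    also have "\<dots> = fscale (lam * coef t lam r2) (g (max t r1) t)"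
      by (simp only: g_coef[OF t, of r2] fvs.scale_scale)
    finally have 1: "gp r2 t = fscale (lam * coef t lam r2) (g (max t r1) t)" .
    have "(if r2 = 0 then 0 else coef t lam (r2 - 1)) = lam * coef t lam r2 - ?P"
      using coef_rec[OF t t r2, of lam] by (simp only: ends mult_zero_right add_0_right simp_thms if_True)
    moreover have "gp r2 t = fscale (if r2 = 0 then 0 else coef t lam (r2 - 1)) (g (max t r1) t)"
      using g_coef[OF t, of "r2 - 1"] by (simp add: gp_def)
    ultimately have 2: "gp r2 t = fscale (lam * coef t lam r2 - ?P) (g (max t r1) t)"
      by (simp only:)
    have "fscale ?P (g (max t r1) t)
        = fscale (lam * coef t lam r2) (g (max t r1) t) - fscale (lam * coef t lam r2 - ?P) (g (max t r1) t)"
      by (simp add: fvs.scale_left_diff_distrib del: fvs.scale_cancel_right)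
    also have "\<dots> = 0"
      by (simp only: 1[symmetric] 2[symmetric] diff_self)
    finally have "fscale ?P (g (max t r1) t) = 0" .
    then show ?thesis
      using \<open>?P \<noteq> 0\<close> fvs.scale_eq_0_iff by blast
  qed
  let ?T = "{t. t \<le> r2 \<and> lam \<in> roots t}"
  let ?h = "\<lambda>t. g (max t r1) t"
  have "f = (\<Sum>t\<in>?T. lift t lam (?h t))"
  proof (rule eq_if_restr_eq[OF fband])
    show "(\<Sum>t\<in>?T. lift t lam (?h t)) \<in> funs_on (band n r1 r2)"
      using lift_funs_on[OF g] by (intro fvs.subspace_sum[OF subspace_funs_on])
  next
    fix i
    have "restr n i (\<Sum>t\<in>?T. lift t lam (?h t))
        = (\<Sum>t\<in>?T. (up n ^^ (i - t)) (fscale (coef t lam i) (?h t)))"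
      using g by (simp add: restr_simps restr_lift up_funpow_simps)
    also have "\<dots> = (\<Sum>t\<in>?T. (up n ^^ (i - t)) (g i t))"
    proof (rule sum.cong)
      fix t assume "t \<in> ?T"
      then have "fscale (coef t lam i) (?h t) = g i t"
        by (intro g_coef[symmetric]) simp
      then show "(up n ^^ (i - t)) (fscale (coef t lam i) (?h t)) = (up n ^^ (i - t)) (g i t)"
        by (rule arg_cong)
    qed simp
    also have "\<dots> = (\<Sum>t\<le>r2. (up n ^^ (i - t)) (g i t))"
    proof (rule sum.mono_neutral_left)
      show "\<forall>t\<in>{..r2} - ?T. (up n ^^ (i - t)) (g i t) = 0"
      proof
        fix t assume "t \<in> {..r2} - ?T"
        then have t: "t \<le> r2" "lam \<notin> roots t"
          by auto
        have "g i t = 0"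
          by (simp only: g_coef[OF t(1), of i] zero[OF t] fvs.scale_zero_right)
        then show "(up n ^^ (i - t)) (g i t) = 0"
          by (simp only: flinear_zero[OF flinear_up_funpow])
      qed
    qed auto
    also have "\<dots> = (\<Sum>t\<le>i. (up n ^^ (i - t)) (g i t))"
    proof (rule sum.mono_neutral_cong)
      show "(up n ^^ (i - t)) (g i t) = 0" if "t \<in> {..i} - {..r2}" for t
        using that by (auto simp: g_def flinear_zero[OF flinear_up_funpow])
      show "(up n ^^ (i - t)) (g i t) = 0" if "t \<in> {..r2} - {..i}" for t
        using that by (auto simp: g_def flinear_zero[OF flinear_up_funpow])
    qed auto
    finally show "restr n i f = restr n i (\<Sum>t\<in>?T. lift t lam (?h t))"
      by (simp add: restr_f)
  qed
  then show ?thesis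
    using g by (intro exI[of _ ?h] conjI allI)
qed

lemma eigsp_eq:
  "eigsp n r1 r2 lam = {\<Sum>t\<in>{t. t \<le> r2 \<and> lam \<in> roots t}. a t | a.
     \<forall>t\<in>{t. t \<le> r2 \<and> lam \<in> roots t}. a t \<in> lift t lam ` harm n t}"
  (is "_ = ?R")
proof (intro equalityI subsetI)
  fix f assume "f \<in> eigsp n r1 r2 lam"
  from eigsp_decomposition[OF this] obtain h where h: "\<forall>t. h t \<in> harm n t"
      "f = (\<Sum>t | t \<le> r2 \<and> lam \<in> roots t. lift t lam (h t))"
    by (elim exE conjE)
  have "\<forall>t\<in>{t. t \<le> r2 \<and> lam \<in> roots t}. lift t lam (h t) \<in> lift t lam ` harm n t"
    using h(1) by simp
  then show "f \<in> ?R"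
    unfolding h(2) by (intro CollectI exI[of _ "\<lambda>t. lift t lam (h t)"] conjI refl)
next
  fix f assume "f \<in> ?R"
  then obtain a where a: "f = (\<Sum>t | t \<le> r2 \<and> lam \<in> roots t. a t)"
      "\<forall>t\<in>{t. t \<le> r2 \<and> lam \<in> roots t}. a t \<in> lift t lam ` harm n t"
    unfolding mem_Collect_eq by (elim exE conjE)
  show "f \<in> eigsp n r1 r2 lam"
    unfolding a(1)
  proof (rule fvs.subspace_sum[OF subspace_eigsp])
    fix t assume "t \<in> {t. t \<le> r2 \<and> lam \<in> roots t}"
    with a(2) obtain h where "h \<in> harm n t" "a t = lift t lam h" "t \<le> r2" "lam \<in> roots t"
      by auto
    then show "a t \<in> eigsp n r1 r2 lam"
      by (simp add: lift_in_eigsp)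
  qed
qed

lemma fdim_eigsp:
  "int (fdim (eigsp n r1 r2 lam)) = (\<Sum>t | t \<le> r2 \<and> lam \<in> roots t. multt n t)"
proof -
  let ?T = "{t. t \<le> r2 \<and> lam \<in> roots t}"
  let ?W = "\<lambda>t. lift t lam ` harm n t"
  have indep: "\<forall>t\<in>?T. a t = 0"
    if a: "\<And>t. t \<in> ?T \<Longrightarrow> a t \<in> ?W t" "(\<Sum>t\<in>?T. a t) = 0" for a
  proof -
    have "\<forall>t\<in>?T. \<exists>h. h \<in> harm n t \<and> a t = lift t lam h"
      using a(1) by blast
    from bchoice[OF this] obtain h where h: "\<And>t. t \<in> ?T \<Longrightarrow> h t \<in> harm n t"
        "\<And>t. t \<in> ?T \<Longrightarrow> a t = lift t lam (h t)"
      by blast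
    have "(\<Sum>t\<in>?T. lift t lam (h t)) = 0"
      using a(2) h(2) by simp
    then have "h t = 0" if "t \<in> ?T" for t
      using lift_independent[of ?T h lam t] h(1) that by simp
    then show ?thesis
      using h(2) by (simp add: flinear_zero[OF flinear_lift])
  qed
  have span: "?W t \<subseteq> fspan ((\<lambda>z. indicator {z}) ` band n r1 r2)" for t
    unfolding funs_on_eq_span[OF finite_band, symmetric] using lift_funs_on by (rule image_subsetI)
  have "finite ?T"
    by (rule finite_subset[of _ "{..r2}"]) auto
  then have "fsubspace {\<Sum>t\<in>?T. a t | a. \<forall>t\<in>?T. a t \<in> ?W t} \<and>
      fdim {\<Sum>t\<in>?T. a t | a. \<forall>t\<in>?T. a t \<in> ?W t} = (\<Sum>t\<in>?T. fdim (?W t))"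
    by (rule fvs.dim_direct_sum_family[OF _ finite_imageI[OF finite_band]
        subspace_lift_image span indep])
  then have "fdim (eigsp n r1 r2 lam) = (\<Sum>t\<in>?T. fdim (?W t))"
    by (simp only: eigsp_eq)
  then show ?thesis
    by (simp add: fdim_lift_image)
qed

text \<open>For a root the lifted space is non-zero because binomial coefficients increase strictly
  up to the middle, which makes \<open>multt n t\<close> positive.\<close>

lemma is_eigenvalue_A_iff:
  "is_eigenvalue_A n r1 r2 lam \<longleftrightarrow> (\<exists>t\<le>r2. lam \<in> roots t)"
proof
  assume "is_eigenvalue_A n r1 r2 lam"
  then obtain f where f: "f \<in> eigsp n r1 r2 lam" "f \<noteq> 0"
    by (auto simp: is_eigenvalue_A_def)
  from eigsp_decomposition[OF f(1)]
  obtain h where "f = (\<Sum>t | t \<le> r2 \<and> lam \<in> roots t. lift t lam (h t))"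
    by (elim exE conjE)
  with f(2) have "{t. t \<le> r2 \<and> lam \<in> roots t} \<noteq> {}"
    by (metis sum.empty)
  then show "\<exists>t\<le>r2. lam \<in> roots t"
    by blast
next
  assume "\<exists>t\<le>r2. lam \<in> roots t"
  then obtain t where t: "t \<le> r2" "lam \<in> roots t"
    by blast
  let ?W = "lift t lam ` harm n t"
  have "fdim ?W > 0"
    using fdim_lift_image[OF t(1), of lam] multt_pos[of t n] t(1) r2_le_half by simp
  moreover have "fdim ?W \<le> 0" if "?W \<subseteq> {0}"
    using fvs.dim_le_card[of ?W "{}"] that by (simp add: fvs.span_empty)
  ultimately obtain f where "f \<in> ?W" "f \<noteq> 0"
    by auto
  then show "is_eigenvalue_A n r1 r2 lam"
    using lift_in_eigsp t by (auto simp: is_eigenvalue_A_def)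
qed

end

theorem theorem1p10:
  fixes n r1 r2 :: nat
  assumes "r1 < r2" and "2 * r2 \<le> n"
  shows
   "(\<forall>t \<le> r2.
       card {lam. eigenvalue (Mt n r1 r2 t) lam} = r2 - max t r1 + 1 \<and>
       (\<forall>lam. eigenvalue (Mt n r1 r2 t) lam \<longrightarrow>
         (\<exists>W. fsubspace W \<and> W \<subseteq> eigsp n r1 r2 lam \<and>
              int (fdim W) = multt n t \<and>
              (\<forall>f \<in> W.
                 (\<forall>i. max t r1 \<le> i \<and> i \<le> r2 \<longrightarrow> restr n i f \<in> Vsp n i t) \<and>
                 (\<forall>x \<in> band n r1 r2. card x < max t r1 \<longrightarrow> f x = 0)) \<and>
              fspan (restr n (max t r1) ` W) = Vsp n (max t r1) t \<and>
              inj_on (restr n (max t r1)) W))) \<and>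
    (\<forall>lam. (is_eigenvalue_A n r1 r2 lam \<longleftrightarrow> (\<exists>t \<le> r2. eigenvalue (Mt n r1 r2 t) lam)) \<and>
           int (fdim (eigsp n r1 r2 lam)) =
             (\<Sum>t \<in> {t. t \<le> r2 \<and> eigenvalue (Mt n r1 r2 t) lam}. multt n t))"
proof -
  interpret hypercube_band n r1 r2
    using assms by unfold_locales
  have set_eq: "{t. t \<le> r2 \<and> eigenvalue (Mt n r1 r2 t) lam} = {t. t \<le> r2 \<and> lam \<in> roots t}" for lam
    using eigenvalue_Mt_iff by blast
  show ?thesis
  proof (intro conjI allI impI)
    fix t assume t: "t \<le> r2"
    show "card {lam. eigenvalue (Mt n r1 r2 t) lam} = r2 - max t r1 + 1"
      using card_roots[OF t] by (simp only: eigenvalue_Mt_iff[OF t] Collect_mem_eq msize_def)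
    fix lam assume "eigenvalue (Mt n r1 r2 t) lam"
    then have lam: "lam \<in> roots t"
      by (simp only: eigenvalue_Mt_iff[OF t])
    let ?W = "lift t lam ` harm n t"
    show "\<exists>W. fsubspace W \<and> W \<subseteq> eigsp n r1 r2 lam \<and> int (fdim W) = multt n t \<and>
        (\<forall>f\<in>W. (\<forall>i. max t r1 \<le> i \<and> i \<le> r2 \<longrightarrow> restr n i f \<in> Vsp n i t) \<and>
          (\<forall>x\<in>band n r1 r2. card x < max t r1 \<longrightarrow> f x = 0)) \<and>
        fspan (restr n (max t r1) ` W) = Vsp n (max t r1) t \<and> inj_on (restr n (max t r1)) W"
    proof (rule exI[of _ ?W], intro conjI ballI)
      show "fsubspace ?W" by (rule subspace_lift_image)
      show "?W \<subseteq> eigsp n r1 r2 lam"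
        using lift_in_eigsp[OF _ t lam] by (rule image_subsetI)
      show "int (fdim ?W) = multt n t" by (rule fdim_lift_image[OF t])
      show "fspan (restr n (max t r1) ` ?W) = Vsp n (max t r1) t" by (rule fspan_restr_lift[OF t])
      show "inj_on (restr n (max t r1)) ?W"
        using inj_on_restr_lift[OF t, of lam] by (auto simp: inj_on_def)
      fix f assume "f \<in> ?W"
      then obtain h where h: "h \<in> harm n t" "f = lift t lam h"
        by blast
      show "\<forall>i. max t r1 \<le> i \<and> i \<le> r2 \<longrightarrow> restr n i f \<in> Vsp n i t"
        using restr_lift_in_Vsp[OF h(1)] by (simp add: h(2))
      show "card x < max t r1 \<longrightarrow> f x = 0" if "x \<in> band n r1 r2" for x
        using lift_vanishes[OF h(1) that] by (simp add: h(2))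
    qed
  next
    fix lam
    show "is_eigenvalue_A n r1 r2 lam \<longleftrightarrow> (\<exists>t\<le>r2. eigenvalue (Mt n r1 r2 t) lam)"
      using eigenvalue_Mt_iff[of _ lam] by (auto simp: is_eigenvalue_A_iff)
    show "int (fdim (eigsp n r1 r2 lam)) =
        (\<Sum>t\<in>{t. t \<le> r2 \<and> eigenvalue (Mt n r1 r2 t) lam}. multt n t)"
      by (simp add: set_eq fdim_eigsp)
  qed
qed

end
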